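(* Consider a Brocard porism $(\Gamma,\mathcal{E})$ of non-equilateral triangles, with circumradius $R$ and Brocard angle $\omega$, and put $\sigma=\cot\omega>\sqrt3$. Choose Cartesian coordinates such that the circumcenter is $X_3=(0,0)$ and the symmedian point $X_6$ lies on the negative $y$-axis. Then the second Brocard triangles $T'$ of the 3-periodics $T$ of $(\Gamma,\mathcal{E})$ are 3-periodics of one fixed Brocard porism $(\Gamma',\mathcal{E}')$, specified as follows. Its circumradius $R'$, circumcenter $X_3'$, Brocard angle $\omega'$ (with $\sigma'=\cot\omega'$), Brocard inellipse semi-axes $(a',b')$, Brocard points $\Omega_1',\Omega_2'$ and the center $X_{182}'$ of its Brocard circle are $$R'=\frac{R\sqrt{\sigma^2-3}}{2\sigma},\qquad X_3'=(0,-R'),\qquad \sigma'=\frac{\sigma^2+3}{2\sigma},$$ $$(a',b')=R'\left(\frac{1}{\sqrt{\sigma'^2+1}},\frac{2}{\sigma'^2+1}\right),$$ $$\Omega_1'=\Omega_2(R',\sigma')+X_3',\qquad \Omega_2'=\Omega_1(R',\sigma')+X_3',\qquad X_{182}'=\left(0,-\frac{3R'(\sigma^2+1)}{4\sigma'\sigma}\right),$$ where $\Omega_{1}(r,s)=\frac{r\sqrt{s^2-3}}{s^2+1}\,(1,-s)$ and $\Omega_{2}(r,s)=\frac{r\sqrt{s^2-3}}{s^2+1}\,(-1,-s)$.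
   Context: For a triangle $T=ABC$ with vertices labelled counterclockwise, the Brocard angle $\omega$ and Brocard points $\Omega_1,\Omega_2$ are defined by $\angle\Omega_1AB=\angle\Omega_1BC=\angle\Omega_1CA=\omega$ and $\angle\Omega_2BA=\angle\Omega_2CB=\angle\Omega_2AC=\omega$. One has $0<\omega\le\pi/6$, with $\omega=\pi/6$ exactly for equilateral triangles. $X_3$ is the circumcenter and $X_6$ the symmedian point. The Brocard circle $\mathcal{K}$ is the circle through $X_3,\Omega_1,\Omega_2$; it has $X_3X_6$ as a diameter, and its center is denoted $X_{182}$. The Brocard inellipse $\mathcal{E}$ is the ellipse tangent to the three sides with foci $\Omega_1,\Omega_2$. A Brocard porism is the pair $(\Gamma,\mathcal{E})$ of circumcircle and Brocard inellipse of a triangle; its 3-periodics are all triangles inscribed in $\Gamma$ and circumscribed about $\mathcal{E}$ (a one-parameter family by Poncelet). All of them have the same $R,\omega,\Omega_1,\Omega_2,X_3,X_6,\mathcal{K}$ (known facts). The second Brocard triangle $T'=A'B'C'$ of $T=ABC$: $A'$ is the intersection, other than $X_6$, of the line $AX_6$ with $\mathcal{K}$ (and $A'=X_6$ if the line is tangent to $\mathcal{K}$), similarly $B'$ and $C'$. Equivalently, $A',B',C'$ are the orthogonal projections of $X_3$ on the lines $AX_6,BX_6,CX_6$. Primed quantities are those of $T'$; the Brocard points $\Omega_1',\Omega_2'$ of $T'$ are defined, with the vertices $A',B',C'$ in this labelling, by the angle equalities $\angle\Omega_1'A'B'=\angle\Omega_1'B'C'=\angle\Omega_1'C'A'=\omega'$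 and $\angle\Omega_2'B'A'=\angle\Omega_2'C'B'=\angle\Omega_2'A'C'=\omega'$. *)

theory Defs
  imports "HOL-Analysis.Analysis"
begin

text \<open>The Euclidean plane is the type \<^typ>\<open>complex\<close>; \<^term>\<open>Complex x y\<close> is the point
  with Cartesian coordinates \<open>(x, y)\<close>. A triangle is three points \<open>A\<close>, \<open>B\<close>, \<open>C\<close> with
  \<^prop>\<open>\<not> collinear {A, B, C}\<close>.

  Points and curves that are unique for a triangle are introduced by definite descriptions, so
  that an equation such as \<open>circumcenter A B C = X\<close> about a concrete \<open>X\<close> carries the existence and
  uniqueness of the object.\<close>

definition counterclockwise :: "complex \<Rightarrow> complex \<Rightarrow> complex \<Rightarrow> bool" where
  "counterclockwise A B C \<longleftrightarrow> Im (cnj (B - A) * (C - A)) > 0"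

definition equilateral :: "complex \<Rightarrow> complex \<Rightarrow> complex \<Rightarrow> bool" where
  "equilateral A B C \<longleftrightarrow> dist A B = dist B C \<and> dist B C = dist C A"

text \<open>\<open>angle P A B\<close> is the unoriented angle \<open>PAB\<close>, with vertex \<open>A\<close> and values in \<open>[0, \<pi>]\<close>.\<close>

definition angle :: "complex \<Rightarrow> complex \<Rightarrow> complex \<Rightarrow> real" where
  "angle P A B = arccos (inner (P - A) (B - A) / (norm (P - A) * norm (B - A)))"

definition circumcenter :: "complex \<Rightarrow> complex \<Rightarrow> complex \<Rightarrow> complex" where
  "circumcenter A B C = (THE X. dist X A = dist X B \<and> dist X B = dist X C)"

definition circumradius :: "complex \<Rightarrow> complex \<Rightarrow> complex \<Rightarrow> real" where
  "circumradius A B C = dist (circumcenter A B C) A"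

definition circumcircle :: "complex \<Rightarrow> complex \<Rightarrow> complex \<Rightarrow> complex set" where
  "circumcircle A B C = sphere (circumcenter A B C) (circumradius A B C)"

text \<open>A symmedian is the mirror image of a median in the bisector of the angle at its vertex. For
  a line through the interior of the triangle this says that it makes the same angle with one side
  as the median makes with the other.\<close>

definition symmedian_point :: "complex \<Rightarrow> complex \<Rightarrow> complex \<Rightarrow> complex" where
  "symmedian_point A B C = (THE K. K \<in> interior (convex hull {A, B, C}) \<and>
     angle K A B = angle (midpoint B C) A C \<and>
     angle K B C = angle (midpoint C A) B A \<and>
     angle K C A = angle (midpoint A B) C B)"

text \<open>The Brocard points are interior to the triangle; with unoriented angles this condition is
  stated explicitly. The definition depends on the order of the vertices and is meaningful for
  both orientations: exchanging two vertices exchanges the two Brocard points.\<close>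

definition is_brocard1 :: "complex \<Rightarrow> complex \<Rightarrow> complex \<Rightarrow> complex \<Rightarrow> real \<Rightarrow> bool" where
  "is_brocard1 A B C P w \<longleftrightarrow> P \<in> interior (convex hull {A, B, C}) \<and>
     angle P A B = w \<and> angle P B C = w \<and> angle P C A = w"

definition is_brocard2 :: "complex \<Rightarrow> complex \<Rightarrow> complex \<Rightarrow> complex \<Rightarrow> real \<Rightarrow> bool" where
  "is_brocard2 A B C P w \<longleftrightarrow> P \<in> interior (convex hull {A, B, C}) \<and>
     angle P B A = w \<and> angle P C B = w \<and> angle P A C = w"

definition brocard_angle :: "complex \<Rightarrow> complex \<Rightarrow> complex \<Rightarrow> real" where
  "brocard_angle A B C = (THE w. \<exists>P Q. is_brocard1 A B C P w \<and> is_brocard2 A B C Q w)"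

definition brocard_point1 :: "complex \<Rightarrow> complex \<Rightarrow> complex \<Rightarrow> complex" where
  "brocard_point1 A B C = (THE P. \<exists>w. is_brocard1 A B C P w)"

definition brocard_point2 :: "complex \<Rightarrow> complex \<Rightarrow> complex \<Rightarrow> complex" where
  "brocard_point2 A B C = (THE P. \<exists>w. is_brocard2 A B C P w)"

text \<open>The Brocard circle is the circle through the circumcenter and the two Brocard points (which
  form a triangle when \<open>ABC\<close> is not equilateral); \<open>X182\<close> is its center.\<close>

definition X182 :: "complex \<Rightarrow> complex \<Rightarrow> complex \<Rightarrow> complex" where
  "X182 A B C = circumcenter (circumcenter A B C) (brocard_point1 A B C) (brocard_point2 A B C)"

definition brocard_circle :: "complex \<Rightarrow> complex \<Rightarrow> complex \<Rightarrow> complex set" where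
  "brocard_circle A B C =
     circumcircle (circumcenter A B C) (brocard_point1 A B C) (brocard_point2 A B C)"

text \<open>\<open>E\<close> is the ellipse with foci \<open>F\<close>, \<open>G\<close> and semi-axes \<open>a \<ge> b > 0\<close>.\<close>

definition is_ellipse :: "complex set \<Rightarrow> complex \<Rightarrow> complex \<Rightarrow> real \<Rightarrow> real \<Rightarrow> bool" where
  "is_ellipse E F G a b \<longleftrightarrow> 0 < b \<and> b \<le> a \<and> (dist F G / 2)\<^sup>2 = a\<^sup>2 - b\<^sup>2 \<and>
     E = {P. dist P F + dist P G = 2 * a}"

text \<open>A line is tangent to an ellipse iff it meets it in exactly one point. For a side of a
  triangle the point of contact lies on the side itself, not on its extension.\<close>

definition side_tangent :: "complex \<Rightarrow> complex \<Rightarrow> complex set \<Rightarrow> bool" where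
  "side_tangent A B E \<longleftrightarrow> (\<exists>P \<in> closed_segment A B. affine hull {A, B} \<inter> E = {P})"

definition circumscribed_about :: "complex \<Rightarrow> complex \<Rightarrow> complex \<Rightarrow> complex set \<Rightarrow> bool" where
  "circumscribed_about A B C E \<longleftrightarrow> side_tangent A B E \<and> side_tangent B C E \<and> side_tangent C A E"

definition brocard_inellipse :: "complex \<Rightarrow> complex \<Rightarrow> complex \<Rightarrow> complex set" where
  "brocard_inellipse A B C = (THE E.
     (\<exists>a b. is_ellipse E (brocard_point1 A B C) (brocard_point2 A B C) a b) \<and>
     circumscribed_about A B C E)"

definition brocard_porism :: "complex set \<Rightarrow> complex set \<Rightarrow> bool" where
  "brocard_porism \<Gamma> E \<longleftrightarrow> (\<exists>A B C. \<not> collinear {A, B, C} \<and>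
     \<Gamma> = circumcircle A B C \<and> E = brocard_inellipse A B C)"

definition three_periodic ::
    "complex set \<Rightarrow> complex set \<Rightarrow> complex \<Rightarrow> complex \<Rightarrow> complex \<Rightarrow> bool" where
  "three_periodic \<Gamma> E A B C \<longleftrightarrow> \<not> collinear {A, B, C} \<and>
     {A, B, C} \<subseteq> \<Gamma> \<and> circumscribed_about A B C E"

text \<open>The vertex of the second Brocard triangle on the line through the vertex \<open>V\<close> and the
  symmedian point \<open>K\<close>. The circle passes through \<open>K\<close>. If the line is a secant, the equation
  below makes \<open>P\<close> the second intersection; if it is tangent at \<open>K\<close>, then \<open>P = K\<close>.\<close>

definition second_brocard_vertex ::
    "complex \<Rightarrow> complex \<Rightarrow> complex \<Rightarrow> complex \<Rightarrow> complex" where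
  "second_brocard_vertex A B C V = (let K = symmedian_point A B C in
     (THE P. affine hull {V, K} \<inter> brocard_circle A B C = {K, P}))"

definition Omega1 :: "real \<Rightarrow> real \<Rightarrow> complex" where
  "Omega1 r s = (r * sqrt (s\<^sup>2 - 3) / (s\<^sup>2 + 1)) *\<^sub>R Complex 1 (- s)"

definition Omega2 :: "real \<Rightarrow> real \<Rightarrow> complex" where
  "Omega2 r s = (r * sqrt (s\<^sup>2 - 3) / (s\<^sup>2 + 1)) *\<^sub>R Complex (- 1) (- s)"

end

(* The projective maps that preserve a disc act on the inscribed triangles. The hyperbolic
   translations of the Klein model along the y-axis, called boosts below, form a one-parameter
   group, and every triangle with circumcenter 0 and symmedian point on the negative y-axis is the image under one
   boost, of parameter t say, of an equilateral triangle: the boost takes the center to the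
   symmedian point, and a triangle whose symmedian point is its circumcenter is equilateral. Hence
   the Brocard porism is the image of the rotations of an equilateral triangle u, rho u, rho^2 u,
   its inellipse is the image of the circle of radius 1/2, and all its invariants are functions of
   R and t, for instance cot omega = sqrt 3 (1 + t^2) / (1 - t^2).

   The foot of the perpendicular from the circumcenter to the symmedian through the vertex u is
   the vertex -i u^2 of a second orbit of this kind, with parameter t^2, radius R t / (1 + t^2) and
   center (0, - R t / (1 + t^2)). Squaring maps the rotated units to rotated units, so T' runs
   through the Brocard porism of that orbit. *)

theory Submission
  imports Defs
begin

text \<open>Boosts and triangle geometry are linked because symmedian and Brocard points have
  barycentric weights built from squared side lengths. For unit preimages a boost multiplies squared
  lengths by a common constant and divides them by the boost weights of both ends. So the squared
  sides of the image of an equilateral triangle are proportional to the weights p, q, r of the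
  opposite vertices, and p + q + r and pq + qr + rp do not change under rotation. This makes the
  invariants constant on the orbit. The circle of the second orbit is the Brocard circle of the
  first: X3 X6 is its diameter, whence the radius R t / (1 + t^2). Squaring is the inscribed angle
  theorem: the line through X6 with direction e^(i phi) meets this circle again at the center plus
  the radius times -i e^(2 i phi). The direction from X6 to the vertex is that of u + t^2 cnj u, and
  on the unit circle a boost is the Moebius map z -> (z - i t) / (1 + i t z); so -i e^(2 i phi) is
  the boost of -i u^2 with parameter t^2.\<close>

section \<open>Symmedian and Brocard points in barycentric coordinates\<close>

lemma cot_inj:
  assumes "0 < x" "x < pi" "0 < y" "y < pi" "cot x = cot y"
  shows "x = y"
proof -
  have s: "sin x > 0" "sin y > 0" using assms by (auto simp: sin_gt_zero)
  have "cos x * sin y = cos y * sin x"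
    using assms(5) s by (simp add: cot_def frac_eq_eq)
  hence "sin (x - y) = 0" by (simp add: sin_diff)
  moreover have "\<bar>x - y\<bar> < pi" using assms by linarith
  ultimately show ?thesis using sin_zero_pi_iff by force
qed

text \<open>Lagrange's identity \<open>lag\<close> expresses the sine as cross product over norms,
  so the norms cancel in the cotangent. Angles are compared by cotangents from here on, since these
  need no square roots.\<close>

lemma cot_angle:
  assumes "Im (cnj (P - A) * (B - A)) \<noteq> 0"
  shows "0 < angle P A B" "angle P A B < pi"
    "cot (angle P A B) = inner (P - A) (B - A) / \<bar>Im (cnj (P - A) * (B - A))\<bar>"
proof -
  define v where "v = P - A"
  define w where "w = B - A"
  have nz: "Im (cnj v * w) \<noteq> 0" using assms by (simp add: v_def w_def)
  hence "v \<noteq> 0" "w \<noteq> 0" by auto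
  hence n: "norm v > 0" "norm w > 0" by auto
  define c where "c = inner v w / (norm v * norm w)"
  have lag: "(norm v * norm w)\<^sup>2 = (inner v w)\<^sup>2 + (Im (cnj v * w))\<^sup>2"
    by (simp add: cmod_power2 inner_complex_def power_mult_distrib) algebra
  have sq: "1 - c\<^sup>2 = (Im (cnj v * w))\<^sup>2 / (norm v * norm w)\<^sup>2"
  proof -
    have "1 - c\<^sup>2 = ((norm v * norm w)\<^sup>2 - (inner v w)\<^sup>2) / (norm v * norm w)\<^sup>2"
      using n by (simp add: c_def power_divide diff_divide_distrib)
    thus ?thesis using lag by simp
  qed
  moreover have "(Im (cnj v * w))\<^sup>2 / (norm v * norm w)\<^sup>2 > 0"
    using nz n by (simp add: zero_less_divide_iff)
  ultimately have "c\<^sup>2 < 1" by linarith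
  hence c: "-1 < c" "c < 1" by (auto simp: abs_square_less_1)
  have ang: "angle P A B = arccos c" by (simp add: angle_def c_def v_def w_def)
  show "0 < angle P A B" "angle P A B < pi"
    using arccos_lt_bounded[of c] c by (auto simp: ang)
  have "sin (arccos c) = sqrt (1 - c\<^sup>2)" using c by (simp add: sin_arccos)
  also have "\<dots> = \<bar>Im (cnj v * w)\<bar> / (norm v * norm w)"
    using n by (simp add: sq real_sqrt_divide)
  finally have "cot (arccos c) = c / (\<bar>Im (cnj v * w)\<bar> / (norm v * norm w))"
    using c by (simp add: cot_def cos_arccos)
  also have "\<dots> = inner v w / \<bar>Im (cnj v * w)\<bar>"
    using n by (simp add: c_def)
  finally show "cot (angle P A B) = inner (P - A) (B - A) / \<bar>Im (cnj (P - A) * (B - A))\<bar>"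
    by (simp add: ang v_def w_def)
qed

text \<open>Collinearity is the equality case of Cauchy-Schwarz, and by Lagrange's identity the
  defect is the squared cross product.\<close>

lemma noncollinear_iff:
  "\<not> collinear {A, B, C :: complex} \<longleftrightarrow> Im (cnj (B - A) * (C - A)) \<noteq> 0"
proof -
  have "collinear {A, B, C} \<longleftrightarrow> collinear {0, B - A, C - A}"
    using collinear_3[of B A C] by (simp add: insert_commute)
  also have "\<dots> \<longleftrightarrow> Im (cnj (B - A) * (C - A)) = 0"
  proof -
    have "collinear {0, v, w} \<longleftrightarrow> Im (cnj v * w) = 0" for v w :: complex
    proof -
      have "(norm v * norm w)\<^sup>2 = (inner v w)\<^sup>2 + (Im (cnj v * w))\<^sup>2"
        by (simp add: cmod_power2 inner_complex_def power_mult_distrib) algebra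
      moreover have "collinear {0, v, w} \<longleftrightarrow> \<bar>inner v w\<bar> = norm v * norm w"
        by (metis norm_cauchy_schwarz_equal)
      moreover have "\<bar>inner v w\<bar> = norm v * norm w \<longleftrightarrow> (inner v w)\<^sup>2 = (norm v * norm w)\<^sup>2"
        by (metis abs_ge_zero abs_mult abs_norm_cancel norm_mult norm_ge_zero power2_abs power2_eq_iff_nonneg)
      ultimately show ?thesis by simp
    qed
    thus ?thesis by blast
  qed
  finally show ?thesis by blast
qed

text \<open>If X and Y are both equidistant from the vertices, X - Y is orthogonal to B - A and to C
  - A, which are independent.\<close>

lemma circumcenter_eqI:
  assumes "\<not> collinear {A, B, C}" "dist X A = dist X B" "dist X B = dist X C"
  shows "circumcenter A B C = X"
  unfolding circumcenter_def
proof (rule the_equality)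
  show "dist X A = dist X B \<and> dist X B = dist X C" using assms by simp
next
  fix Y assume Y: "dist Y A = dist Y B \<and> dist Y B = dist Y C"
  have *: "inner (X - Y) (B - A) = 0" if "dist X A = dist X B" "dist Y A = dist Y B" for A B
  proof -
    have "(dist X A)\<^sup>2 = (dist X B)\<^sup>2" "(dist Y A)\<^sup>2 = (dist Y B)\<^sup>2" using that by auto
    thus ?thesis
      by (simp add: dist_norm power2_norm_eq_inner inner_diff_left inner_diff_right inner_commute)
  qed
  have 1: "inner (X - Y) (B - A) = 0" "inner (X - Y) (C - A) = 0"
    using *[of A B] *[of A C] assms Y by auto
  have D: "Im (cnj (B - A) * (C - A)) \<noteq> 0" using assms(1) noncollinear_iff by blast
  have "Re (X - Y) * Im (cnj (B - A) * (C - A)) = 0" "Im (X - Y) * Im (cnj (B - A) * (C - A)) = 0"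
    using 1 by (simp_all add: inner_complex_def) algebra+
  thus "Y = X" using D by (simp add: complex_eq_iff)
qed

lemma cot_surj: "\<exists>w. 0 < w \<and> w < pi \<and> cot w = (s::real)"
proof (intro exI conjI)
  show "0 < pi / 2 - arctan s" "pi / 2 - arctan s < pi"
    using arctan_bounded[of s] by auto
  show "cot (pi / 2 - arctan s) = s"
    using tan_arctan[of s] by (simp add: cot_def tan_def sin_diff cos_diff)
qed

lemma angle_eq_iff_cot:
  assumes "Im (cnj (P - A) * (B - A)) \<noteq> 0"
  shows "angle P A B = w \<longleftrightarrow> 0 < w \<and> w < pi \<and> cot (angle P A B) = cot w"
  using cot_angle[OF assms] cot_inj by blast

text \<open>In the basis B - A, C - A of P - A the cross product sees only the coefficient z, so the
  cotangent is affine in y / z. Signs of x and y are left free: a median is the case x = 0.\<close>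

lemma barycentric_angle:
  assumes "\<not> collinear {A, B, C}" "x + y + z = 1" "z > 0" "x *\<^sub>R A + y *\<^sub>R B + z *\<^sub>R C = P"
  shows "Im (cnj (P - A) * (B - A)) \<noteq> 0"
    and "cot (angle P A B) =
      (y / z * (dist A B)\<^sup>2 + inner (B - A) (C - A)) / \<bar>Im (cnj (B - A) * (C - A))\<bar>"
proof -
  define D where "D = Im (cnj (B - A) * (C - A))"
  have D: "D \<noteq> 0" using assms(1) unfolding D_def noncollinear_iff .
  have x: "x = 1 - y - z" using assms(2) by simp
  have P: "P - A = y *\<^sub>R (B - A) + z *\<^sub>R (C - A)"
    unfolding assms(4)[symmetric] x by (simp add: algebra_simps)
  have 1: "Im (cnj (P - A) * (B - A)) = - z * D"
    unfolding P D_def by (simp add: algebra_simps)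
  thus nz: "Im (cnj (P - A) * (B - A)) \<noteq> 0" using D assms(3) by simp
  have 2: "inner (P - A) (B - A) = y * (dist A B)\<^sup>2 + z * inner (B - A) (C - A)"
    unfolding P by (simp add: inner_add_left dist_norm norm_minus_commute[of A] power2_norm_eq_inner inner_commute[of "C - A"])
  have "cot (angle P A B) = (y * (dist A B)\<^sup>2 + z * inner (B - A) (C - A)) / (z * \<bar>D\<bar>)"
    using cot_angle(3)[OF nz] assms(3) unfolding 1 2 by (simp add: abs_mult)
  also have "\<dots> = (y / z * (dist A B)\<^sup>2 + inner (B - A) (C - A)) / \<bar>D\<bar>"
    using assms(3) D by (simp add: field_simps)
  finally show "cot (angle P A B) = (y / z * (dist A B)\<^sup>2 + inner (B - A) (C - A)) / \<bar>Im (cnj (B - A) * (C - A))\<bar>"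
    by (simp add: D_def)
qed

lemma cross_rotate:
  "Im (cnj (C - B) * (A - B)) = Im (cnj (B - A) * (C - A))"
  by (simp add: algebra_simps)

lemma abs_cross_swap:
  "\<bar>Im (cnj (C - A) * (B - A))\<bar> = \<bar>Im (cnj (B - A) * (C - A))\<bar>"
proof -
  have "Im (cnj (C - A) * (B - A)) = - Im (cnj (B - A) * (C - A))" by (simp add: algebra_simps)
  thus ?thesis by (metis abs_minus_cancel)
qed

lemma interior_triangle:
  fixes A B C :: complex
  assumes "\<not> collinear {A, B, C}"
  shows "P \<in> interior (convex hull {A, B, C}) \<longleftrightarrow>
    (\<exists>x y z. 0 < x \<and> 0 < y \<and> 0 < z \<and> x + y + z = 1 \<and> x *\<^sub>R A + y *\<^sub>R B + z *\<^sub>R C = P)"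
  using interior_convex_hull_3_minimal[OF assms] by simp

text \<open>Both cotangents contain the same inner product of the sides at A and the same cross
  product, so only the terms with the ratios of the weights have to agree.\<close>

lemma angle_eq_median_angle_iff:
  assumes "\<not> collinear {A, B, C}" "x + y + z = 1" "z > 0" "x *\<^sub>R A + y *\<^sub>R B + z *\<^sub>R C = K"
  shows "angle K A B = angle (midpoint B C) A C \<longleftrightarrow> y * (dist A B)\<^sup>2 = z * (dist C A)\<^sup>2"
proof -
  have nc: "\<not> collinear {A, C, B}" using assms(1) by (simp add: insert_commute)
  have m: "0 *\<^sub>R A + (1/2) *\<^sub>R C + (1/2) *\<^sub>R B = midpoint B C"
    by (simp add: midpoint_def scaleR_add_right add.commute)
  note 1 = barycentric_angle[OF assms]
  note 2 = barycentric_angle[OF nc _ _ m, simplified]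
  have D: "Im (cnj (B - A) * (C - A)) \<noteq> 0" using assms(1) noncollinear_iff by blast
  have "angle K A B = angle (midpoint B C) A C \<longleftrightarrow> cot (angle K A B) = cot (angle (midpoint B C) A C)"
    using angle_eq_iff_cot[OF 1(1)] cot_angle[of "midpoint B C" A C] 2(1) by auto
  also have "cot (angle (midpoint B C) A C) =
      ((dist C A)\<^sup>2 + inner (B - A) (C - A)) / \<bar>Im (cnj (B - A) * (C - A))\<bar>"
    using barycentric_angle(2)[OF nc _ _ m] unfolding abs_cross_swap[of C A B]
    by (simp only: inner_commute dist_commute) simp
  also have "cot (angle K A B) = \<dots> \<longleftrightarrow> y / z * (dist A B)\<^sup>2 = (dist C A)\<^sup>2"
    using D unfolding 1(2) by (simp add: divide_cancel_right)
  also have "\<dots> \<longleftrightarrow> y * (dist A B)\<^sup>2 = z * (dist C A)\<^sup>2"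
    using assms(3) by (auto simp: field_simps)
  finally show ?thesis .
qed

lemma noncollinear_distinct:
  assumes "\<not> collinear {A, B, C}" shows "A \<noteq> B" "B \<noteq> C" "C \<noteq> A"
  using assms by (auto simp: insert_commute)

text \<open>Each angle condition fixes one ratio of barycentric weights, and together they force the
  squared side lengths. The second claim later puts the point strictly inside the
  circumcircle.\<close>

lemma symmedian_point_eq:
  assumes nc: "\<not> collinear {A, B, C}"
    and abc: "a = (dist B C)\<^sup>2" "b = (dist C A)\<^sup>2" "c = (dist A B)\<^sup>2"
  shows "symmedian_point A B C = (1 / (a + b + c)) *\<^sub>R (a *\<^sub>R A + b *\<^sub>R B + c *\<^sub>R C)"
    and "symmedian_point A B C \<in> interior (convex hull {A, B, C})"
proof -
  have pos: "a > 0" "b > 0" "c > 0" using noncollinear_distinct[OF nc] by (auto simp: abc)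
  define S where "S = a + b + c"
  have S: "S > 0" using pos by (simp add: S_def)
  define K where "K = (1 / S) *\<^sub>R (a *\<^sub>R A + b *\<^sub>R B + c *\<^sub>R C)"
  have nc': "\<not> collinear {B, C, A}" "\<not> collinear {C, A, B}" using nc by (simp_all add: insert_commute)
  let ?P = "\<lambda>K. K \<in> interior (convex hull {A, B, C}) \<and>
     angle K A B = angle (midpoint B C) A C \<and>
     angle K B C = angle (midpoint C A) B A \<and>
     angle K C A = angle (midpoint A B) C B"
  have key: "?P K \<longleftrightarrow> y * c = z * b \<and> z * a = x * c \<and> x * b = y * a"
    if h: "0 < x" "0 < y" "0 < z" "x + y + z = 1" "x *\<^sub>R A + y *\<^sub>R B + z *\<^sub>R C = K" for x y z K
  proof -
    have "K \<in> interior (convex hull {A, B, C})"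
      unfolding interior_triangle[OF nc] using h by blast
    moreover have "y *\<^sub>R B + z *\<^sub>R C + x *\<^sub>R A = K" "z *\<^sub>R C + x *\<^sub>R A + y *\<^sub>R B = K"
      using h(5) by (simp_all add: algebra_simps)
    moreover have "y + z + x = 1" "z + x + y = 1" using h by auto
    ultimately show ?thesis
      using angle_eq_median_angle_iff[OF nc h(4,3,5)] angle_eq_median_angle_iff[OF nc'(1), of y z x K]
        angle_eq_median_angle_iff[OF nc'(2), of z x y K] h abc by auto
  qed
  have sum1: "a / S + b / S + c / S = 1"
    using S by (simp add: S_def add_divide_distrib[symmetric])
  have K': "(a / S) *\<^sub>R A + (b / S) *\<^sub>R B + (c / S) *\<^sub>R C = K"
    by (simp add: K_def scaleR_add_right)
  have PK: "?P K" using key[OF _ _ _ sum1 K'] pos S by simp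
  have "symmedian_point A B C = K"
    unfolding symmedian_point_def
  proof (rule the_equality[of ?P, OF PK])
    fix L assume L: "?P L"
    then obtain x y z where h: "0 < x" "0 < y" "0 < z" "x + y + z = 1" "x *\<^sub>R A + y *\<^sub>R B + z *\<^sub>R C = L"
      unfolding interior_triangle[OF nc] by blast
    have e: "y * c = z * b" "z * a = x * c" "x * b = y * a" using key[OF h] L by auto
    have x1: "x = 1 - y - z" using h(4) by simp
    have "x * S = a" "y * S = b" "z * S = c" using e unfolding S_def x1 by algebra+
    hence "x = a / S" "y = b / S" "z = c / S" using S by (auto simp: field_simps)
    thus "L = K" using h(5) K' by simp
  qed
  thus "symmedian_point A B C = (1 / (a + b + c)) *\<^sub>R (a *\<^sub>R A + b *\<^sub>R B + c *\<^sub>R C)"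
    by (simp add: K_def S_def)
  show "symmedian_point A B C \<in> interior (convex hull {A, B, C})"
    using PK \<open>symmedian_point A B C = K\<close> by simp
qed

lemma dist_sq_eq_inner_sum:
  fixes A B C :: complex
  shows "(dist A B)\<^sup>2 = inner (B - A) (C - A) + inner (C - B) (A - B)"
  by (simp add: dist_norm power2_norm_eq_inner inner_complex_def algebra_simps)

text \<open>The left side of \<open>eq\<close> increases strictly with k, and k = \<alpha> + \<beta>
  + \<gamma> solves it. This is the uniqueness of the Brocard angle, whose cotangent is the sum of
  the cotangents of the angles of the triangle.\<close>

lemma prod3_eq_sum_unique:
  fixes k \<alpha> \<beta> \<gamma> :: real
  assumes "k > \<alpha>" "k > \<beta>" "k > \<gamma>" "\<alpha> + \<beta> > 0" "\<beta> + \<gamma> > 0" "\<gamma> + \<alpha> > 0"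
    and eq: "(k - \<alpha>) * (k - \<beta>) * (k - \<gamma>) = (\<beta> + \<gamma>) * (\<gamma> + \<alpha>) * (\<alpha> + \<beta>)"
  shows "k = \<alpha> + \<beta> + \<gamma>"
proof (rule ccontr)
  assume "k \<noteq> \<alpha> + \<beta> + \<gamma>"
  then consider "k > \<alpha> + \<beta> + \<gamma>" | "k < \<alpha> + \<beta> + \<gamma>" by linarith
  thus False
  proof cases
    case 1
    have "(\<beta> + \<gamma>) * (\<gamma> + \<alpha>) < (k - \<alpha>) * (k - \<beta>)"
      by (rule mult_strict_mono) (use assms 1 in auto)
    hence "(\<beta> + \<gamma>) * (\<gamma> + \<alpha>) * (\<alpha> + \<beta>) < (k - \<alpha>) * (k - \<beta>) * (k - \<gamma>)"
      by (rule mult_strict_mono) (use assms 1 in auto)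
    thus False using eq by simp
  next
    case 2
    have "(k - \<alpha>) * (k - \<beta>) < (\<beta> + \<gamma>) * (\<gamma> + \<alpha>)"
      by (rule mult_strict_mono) (use assms 2 in auto)
    hence "(k - \<alpha>) * (k - \<beta>) * (k - \<gamma>) < (\<beta> + \<gamma>) * (\<gamma> + \<alpha>) * (\<alpha> + \<beta>)"
      by (rule mult_strict_mono) (use assms 2 in auto)
    thus False using eq by simp
  qed
qed

text \<open>The angle conditions are three equations for two free weights and k = D cot w.
  Eliminating the weights determines k, and then the ratios of the weights follow.\<close>

lemma is_brocard1_iff:
  assumes nc: "\<not> collinear {A, B, C}"
    and abc: "a = (dist B C)\<^sup>2" "b = (dist C A)\<^sup>2" "c = (dist A B)\<^sup>2"
  shows "is_brocard1 A B C P w \<longleftrightarrow>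
    P = (1 / (c * a + a * b + b * c)) *\<^sub>R ((c * a) *\<^sub>R A + (a * b) *\<^sub>R B + (b * c) *\<^sub>R C) \<and>
    0 < w \<and> w < pi \<and> cot w = (a + b + c) / (2 * \<bar>Im (cnj (B - A) * (C - A))\<bar>)"
proof -
  have pos: "a > 0" "b > 0" "c > 0" using noncollinear_distinct[OF nc] by (auto simp: abc)
  define S where "S = c * a + a * b + b * c"
  have S: "S > 0" using pos by (simp add: S_def add_pos_pos)
  define Q where "Q = (1 / S) *\<^sub>R ((c * a) *\<^sub>R A + (a * b) *\<^sub>R B + (b * c) *\<^sub>R C)"
  define D where "D = \<bar>Im (cnj (B - A) * (C - A))\<bar>"
  have D: "D > 0" using nc unfolding noncollinear_iff D_def by simp
  \<comment> \<open>Divided by D, these three numbers are the cotangents of the angles of the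
    triangle; their pairwise sums are the squared sides.\<close>
  define \<alpha> where "\<alpha> = inner (B - A) (C - A)"
  define \<beta> where "\<beta> = inner (C - B) (A - B)"
  define \<gamma> where "\<gamma> = inner (A - C) (B - C)"
  have s: "c = \<alpha> + \<beta>" "a = \<beta> + \<gamma>" "b = \<gamma> + \<alpha>"
    unfolding abc \<alpha>_def \<beta>_def \<gamma>_def
    using dist_sq_eq_inner_sum[of A B C] dist_sq_eq_inner_sum[of B C A] dist_sq_eq_inner_sum[of C A B] by simp_all
  have nc': "\<not> collinear {B, C, A}" "\<not> collinear {C, A, B}" using nc by (simp_all add: insert_commute)
  have key: "is_brocard1 A B C P w \<longleftrightarrow> 0 < w \<and> w < pi \<and>
      y / z * c + \<alpha> = D * cot w \<and> z / x * a + \<beta> = D * cot w \<and> x / y * b + \<gamma> = D * cot w"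
    if h: "0 < x" "0 < y" "0 < z" "x + y + z = 1" "x *\<^sub>R A + y *\<^sub>R B + z *\<^sub>R C = P" for x y z P
  proof -
    have "P \<in> interior (convex hull {A, B, C})"
      unfolding interior_triangle[OF nc] using h by blast
    moreover have h': "y *\<^sub>R B + z *\<^sub>R C + x *\<^sub>R A = P" "z *\<^sub>R C + x *\<^sub>R A + y *\<^sub>R B = P"
      using h(5) by (simp_all add: algebra_simps)
    moreover have h'': "y + z + x = 1" "z + x + y = 1" using h by auto
    note 1 = barycentric_angle[OF nc h(4,3,5)]
    note 2 = barycentric_angle[OF nc'(1) h''(1) h(1) h'(1)]
    note 3 = barycentric_angle[OF nc'(2) h''(2) h(2) h'(2)]
    have "cot (angle P A B) = (y / z * c + \<alpha>) / D" using 1(2) by (simp add: abc \<alpha>_def D_def)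
    moreover have "cot (angle P B C) = (z / x * a + \<beta>) / D"
      unfolding 2(2) cross_rotate[of C B A] by (simp add: abc \<beta>_def D_def)
    moreover have "cot (angle P C A) = (x / y * b + \<gamma>) / D"
      unfolding 3(2) cross_rotate[of A C B] cross_rotate[of C B A] by (simp add: abc \<gamma>_def D_def)
    ultimately show ?thesis
      unfolding is_brocard1_def angle_eq_iff_cot[OF 1(1)] angle_eq_iff_cot[OF 2(1)] angle_eq_iff_cot[OF 3(1)]
      using D by (auto simp: divide_eq_eq mult.commute)
  qed
  have k0: "(a + b + c) / (2 * D) = (\<alpha> + \<beta> + \<gamma>) / D" unfolding s using D by (simp add: field_simps)
  have Q: "(c * a / S) *\<^sub>R A + (a * b / S) *\<^sub>R B + (b * c / S) *\<^sub>R C = Q"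
    by (simp add: Q_def scaleR_add_right)
  have Q1: "c * a / S + a * b / S + b * c / S = 1"
    using S by (simp add: S_def add_divide_distrib[symmetric])
  have Qpos: "0 < c * a / S" "0 < a * b / S" "0 < b * c / S" using pos S by auto
  have rat: "(a * b / S) / (b * c / S) * c = a" "(b * c / S) / (c * a / S) * a = b"
     "(c * a / S) / (a * b / S) * b = c" using pos S by simp_all
  have keyQ: "is_brocard1 A B C Q w \<longleftrightarrow> 0 < w \<and> w < pi \<and> \<alpha> + \<beta> + \<gamma> = D * cot w"
    unfolding key[OF Qpos Q1 Q] unfolding rat unfolding s by (auto simp: algebra_simps)
  have "is_brocard1 A B C P w \<longleftrightarrow> P = Q \<and> 0 < w \<and> w < pi \<and> cot w = (a + b + c) / (2 * D)"
  proof
    assume L: "is_brocard1 A B C P w"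
    then obtain x y z where h: "0 < x" "0 < y" "0 < z" "x + y + z = 1" "x *\<^sub>R A + y *\<^sub>R B + z *\<^sub>R C = P"
      unfolding interior_triangle[OF nc] is_brocard1_def by blast
    define k where "k = D * cot w"
    have e: "y / z * c + \<alpha> = k" "z / x * a + \<beta> = k" "x / y * b + \<gamma> = k"
      using key[OF h] L by (auto simp: k_def)
    have e': "k - \<alpha> = y / z * c" "k - \<beta> = z / x * a" "k - \<gamma> = x / y * b" using e by auto
    have "k = \<alpha> + \<beta> + \<gamma>"
    proof (rule prod3_eq_sum_unique)
      have "y / z * c > 0" "z / x * a > 0" "x / y * b > 0" using h pos by auto
      thus "k > \<alpha>" "k > \<beta>" "k > \<gamma>" using e' by linarith+
      show "\<alpha> + \<beta> > 0" "\<beta> + \<gamma> > 0" "\<gamma> + \<alpha> > 0" using s pos by auto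
      \<comment> \<open>In the product of the three equations the ratios y/z, z/x, x/y
        cancel.\<close>
      have "(k - \<alpha>) * (k - \<beta>) * (k - \<gamma>) = a * b * c"
        unfolding e' using h by simp
      thus "(k - \<alpha>) * (k - \<beta>) * (k - \<gamma>) = (\<beta> + \<gamma>) * (\<gamma> + \<alpha>) * (\<alpha> + \<beta>)" using s by simp
    qed
    hence "y / z * c = a" "z / x * a = b" using e' s by linarith+
    hence f: "y * c = z * a" "z * a = x * b" using h by (auto simp: field_simps)
    have x1: "x = 1 - y - z" using h(4) by simp
    have "x * S = c * a" "y * S = a * b" "z * S = b * c" using f unfolding S_def x1 by algebra+
    hence "x = c * a / S" "y = a * b / S" "z = b * c / S" using S by (auto simp: field_simps)
    hence "P = Q" using h(5) Q by simp
    moreover have "0 < w \<and> w < pi" using key[OF h] L by simp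
    moreover have "cot w = (a + b + c) / (2 * D)"
      unfolding k0 using \<open>k = \<alpha> + \<beta> + \<gamma>\<close> D by (simp add: k_def field_simps)
    ultimately show "P = Q \<and> 0 < w \<and> w < pi \<and> cot w = (a + b + c) / (2 * D)" by simp
  next
    assume "P = Q \<and> 0 < w \<and> w < pi \<and> cot w = (a + b + c) / (2 * D)"
    thus "is_brocard1 A B C P w" using keyQ D unfolding k0 by (simp add: field_simps)
  qed
  thus ?thesis by (simp add: Q_def S_def D_def)
qed

lemma is_brocard2_swap: "is_brocard2 A B C P w \<longleftrightarrow> is_brocard1 A C B P w"
  by (auto simp: is_brocard1_def is_brocard2_def insert_commute)

text \<open>The second point is the first one after exchanging B and C. The cotangent is symmetric
  under this exchange, so one angle serves both points, as \<open>brocard_angle\<close>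
  demands.\<close>

lemma brocard_points_eq:
  assumes nc: "\<not> collinear {A, B, C}"
    and abc: "a = (dist B C)\<^sup>2" "b = (dist C A)\<^sup>2" "c = (dist A B)\<^sup>2"
  shows brocard_point1_eq: "brocard_point1 A B C =
      (1 / (c * a + a * b + b * c)) *\<^sub>R ((c * a) *\<^sub>R A + (a * b) *\<^sub>R B + (b * c) *\<^sub>R C)"
    and brocard_point2_eq: "brocard_point2 A B C =
      (1 / (c * a + a * b + b * c)) *\<^sub>R ((a * b) *\<^sub>R A + (b * c) *\<^sub>R B + (c * a) *\<^sub>R C)"
    and cot_brocard_angle: "cot (brocard_angle A B C) =
      (a + b + c) / (2 * \<bar>Im (cnj (B - A) * (C - A))\<bar>)"
proof -
  define k where "k = (a + b + c) / (2 * \<bar>Im (cnj (B - A) * (C - A))\<bar>)"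
  obtain w where w: "0 < w" "w < pi" "cot w = k" using cot_surj by blast
  have b1: "is_brocard1 A B C P v \<longleftrightarrow> P = (1 / (c * a + a * b + b * c)) *\<^sub>R ((c * a) *\<^sub>R A + (a * b) *\<^sub>R B + (b * c) *\<^sub>R C)
      \<and> 0 < v \<and> v < pi \<and> cot v = k" for P v
    using is_brocard1_iff[OF assms] by (simp add: k_def)
  have nc': "\<not> collinear {A, C, B}" using nc by (simp add: insert_commute)
  have b2: "is_brocard2 A B C P v \<longleftrightarrow> P = (1 / (c * a + a * b + b * c)) *\<^sub>R ((a * b) *\<^sub>R A + (b * c) *\<^sub>R B + (c * a) *\<^sub>R C)
      \<and> 0 < v \<and> v < pi \<and> cot v = k" for P v
  proof -
    have "(1 / (b * a + a * c + c * b)) *\<^sub>R ((b * a) *\<^sub>R A + (a * c) *\<^sub>R C + (c * b) *\<^sub>R B) =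
        (1 / (c * a + a * b + b * c)) *\<^sub>R ((a * b) *\<^sub>R A + (b * c) *\<^sub>R B + (c * a) *\<^sub>R C)"
      by (simp add: ac_simps)
    moreover have "(a + c + b) / (2 * \<bar>Im (cnj (C - A) * (B - A))\<bar>) = k"
      unfolding k_def abs_cross_swap[of C A B] by (simp add: ac_simps)
    moreover have "a = (dist C B)\<^sup>2" "c = (dist B A)\<^sup>2" "b = (dist A C)\<^sup>2"
      using abc by (simp_all add: dist_commute)
    ultimately show ?thesis
      using is_brocard1_iff[OF nc', of a c b P v] unfolding is_brocard2_swap by simp
  qed
  show "brocard_point1 A B C =
      (1 / (c * a + a * b + b * c)) *\<^sub>R ((c * a) *\<^sub>R A + (a * b) *\<^sub>R B + (b * c) *\<^sub>R C)"
    unfolding brocard_point1_def b1 using w by (intro the_equality) blast+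
  show "brocard_point2 A B C =
      (1 / (c * a + a * b + b * c)) *\<^sub>R ((a * b) *\<^sub>R A + (b * c) *\<^sub>R B + (c * a) *\<^sub>R C)"
    unfolding brocard_point2_def b2 using w by (intro the_equality) blast+
  have "brocard_angle A B C = w"
    unfolding brocard_angle_def b1 b2 using w cot_inj by (intro the_equality) blast+
  thus "cot (brocard_angle A B C) = (a + b + c) / (2 * \<bar>Im (cnj (B - A) * (C - A))\<bar>)"
    using w k_def by simp
qed

section \<open>Ellipses with given foci\<close>

text \<open>The difference of the squared focal distances is linear in x, so d1 + d2 = 2 a yields
  the focus-directrix form a d1 = a^2 - f x, and squaring gives the quadric.\<close>

lemma ellipse_eq_quadric:
  assumes "0 < b" "b \<le> a" "f\<^sup>2 = a\<^sup>2 - b\<^sup>2"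
  shows "dist z (Complex f 0) + dist z (Complex (- f) 0) = 2 * a \<longleftrightarrow>
    (Re z)\<^sup>2 / a\<^sup>2 + (Im z)\<^sup>2 / b\<^sup>2 = 1"
proof -
  define x where "x = Re z"
  define y where "y = Im z"
  define d1 where "d1 = dist z (Complex f 0)"
  define d2 where "d2 = dist z (Complex (- f) 0)"
  have a: "a > 0" using assms by simp
  have d1: "d1\<^sup>2 = (x - f)\<^sup>2 + y\<^sup>2" and d2: "d2\<^sup>2 = (x + f)\<^sup>2 + y\<^sup>2"
    by (simp_all add: d1_def d2_def x_def y_def dist_norm cmod_power2)
  have pos: "d1 \<ge> 0" "d2 \<ge> 0" by (simp_all add: d1_def d2_def)
  have quad: "x\<^sup>2 / a\<^sup>2 + y\<^sup>2 / b\<^sup>2 = 1 \<longleftrightarrow> b\<^sup>2 * x\<^sup>2 + a\<^sup>2 * y\<^sup>2 = a\<^sup>2 * b\<^sup>2"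
    using a assms(1) by (auto simp: field_simps)
  have "d1 + d2 = 2 * a \<longleftrightarrow> b\<^sup>2 * x\<^sup>2 + a\<^sup>2 * y\<^sup>2 = a\<^sup>2 * b\<^sup>2"
  proof
    assume s: "d1 + d2 = 2 * a"
    have "(d1 + d2) * (d1 - d2) = - 4 * f * x" using d1 d2 by algebra
    hence "a * d1 = a * a - f * x" using s by algebra
    hence "(a * a - f * x)\<^sup>2 = a\<^sup>2 * ((x - f)\<^sup>2 + y\<^sup>2)" using d1 by (metis power_mult_distrib)
    thus "b\<^sup>2 * x\<^sup>2 + a\<^sup>2 * y\<^sup>2 = a\<^sup>2 * b\<^sup>2" using assms(3) by algebra
  next
    assume q: "b\<^sup>2 * x\<^sup>2 + a\<^sup>2 * y\<^sup>2 = a\<^sup>2 * b\<^sup>2"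
    \<comment> \<open>The converse must undo the squaring: bounding |x| and |f| by a makes a^2 - f x
      and a^2 + f x nonnegative.\<close>
    have "0 \<le> a\<^sup>2 * y\<^sup>2" by simp
    hence "b\<^sup>2 * x\<^sup>2 \<le> a\<^sup>2 * b\<^sup>2" using q by linarith
    hence "b\<^sup>2 * x\<^sup>2 \<le> b\<^sup>2 * a\<^sup>2" by (simp only: mult.commute)
    hence "x\<^sup>2 \<le> a\<^sup>2" using assms(1) by simp
    hence x: "\<bar>x\<bar> \<le> a" using a by (simp add: abs_le_square_iff[symmetric])
    have "f\<^sup>2 \<le> a\<^sup>2" using assms(3) by simp
    hence f: "\<bar>f\<bar> \<le> a" using a by (simp add: abs_le_square_iff[symmetric])
    have "\<bar>f * x\<bar> \<le> a * a" unfolding abs_mult by (rule mult_mono) (use x f a in auto)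
    hence nn: "a * a - f * x \<ge> 0" "a * a + f * x \<ge> 0" by auto
    have b: "b\<^sup>2 = a\<^sup>2 - f\<^sup>2" using assms(3) by simp
    have y: "a\<^sup>2 * y\<^sup>2 = a\<^sup>2 * (a\<^sup>2 - f\<^sup>2) - (a\<^sup>2 - f\<^sup>2) * x\<^sup>2" using q unfolding b by simp
    have "(a * d1)\<^sup>2 = a\<^sup>2 * (x - f)\<^sup>2 + a\<^sup>2 * y\<^sup>2" "(a * d2)\<^sup>2 = a\<^sup>2 * (x + f)\<^sup>2 + a\<^sup>2 * y\<^sup>2"
      by (simp_all add: power_mult_distrib d1 d2 distrib_left)
    hence "(a * d1)\<^sup>2 = (a * a - f * x)\<^sup>2" "(a * d2)\<^sup>2 = (a * a + f * x)\<^sup>2"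
      unfolding y by (simp_all add: power2_eq_square algebra_simps)
    hence "a * d1 = a * a - f * x" "a * d2 = a * a + f * x"
      using nn pos a by (simp_all add: power2_eq_iff_nonneg)
    hence "a * (d1 + d2) = a * (2 * a)" by (simp add: algebra_simps)
    thus "d1 + d2 = 2 * a" using a by simp
  qed
  thus ?thesis using quad by (simp add: d1_def d2_def x_def y_def)
qed

text \<open>Intermediate value theorem along a ray that starts strictly inside the ellipse. Used
  with V and with -V it yields two points on one line.\<close>

lemma confocal_level_two_points:
  fixes P V F G :: complex
  assumes "V \<noteq> 0" "dist P F + dist P G < k"
  shows "\<exists>s>0. dist (P + s *\<^sub>R V) F + dist (P + s *\<^sub>R V) G = k"
proof -
  define g where "g s = dist (P + s *\<^sub>R V) F + dist (P + s *\<^sub>R V) G" for s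
  \<comment> \<open>So far out that the triangle inequality makes the distance to F alone at least
    |k|.\<close>
  define M where "M = (\<bar>k\<bar> + dist P F) / norm V"
  have M: "M \<ge> 0" by (simp add: M_def)
  have "M *\<^sub>R V = (P + M *\<^sub>R V - F) - (P - F)" by simp
  hence "norm (M *\<^sub>R V) \<le> dist (P + M *\<^sub>R V) F + dist P F"
    by (metis dist_norm norm_triangle_ineq4)
  moreover have "norm (M *\<^sub>R V) = \<bar>k\<bar> + dist P F"
    using assms(1) by (simp add: M_def)
  ultimately have "k \<le> g M" unfolding g_def using zero_le_dist[of "P + M *\<^sub>R V" G] by linarith
  moreover have "g 0 < k" using assms(2) by (simp add: g_def)
  moreover have "continuous_on {0..M} g" unfolding g_def by (intro continuous_intros)
  ultimately obtain s where s: "0 \<le> s" "s \<le> M" "g s = k"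
    using IVT'[of g 0 k M] M by auto
  hence "s \<noteq> 0" using \<open>g 0 < k\<close> by auto
  thus ?thesis using s unfolding g_def by (intro exI[of _ s]) auto
qed

text \<open>If l < k, a point of the line on level l lies strictly inside level k, so the line
  crosses level k on both sides of it and cannot touch at a single point.\<close>

lemma tangent_confocal_le:
  fixes A B F G Q :: complex
  assumes "A \<noteq> B" "affine hull {A, B} \<inter> {P. dist P F + dist P G = k} = {Q}"
    "affine hull {A, B} \<inter> {P. dist P F + dist P G = l} \<noteq> {}"
  shows "k \<le> l"
proof (rule ccontr)
  assume "\<not> k \<le> l"
  obtain P where P: "P \<in> affine hull {A, B}" "dist P F + dist P G = l" using assms(3) by blast
  have lt: "dist P F + dist P G < k" using P \<open>\<not> k \<le> l\<close> by simp
  have nz: "B - A \<noteq> 0" "A - B \<noteq> 0" using assms(1) by auto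
  obtain s where s: "s > 0" "dist (P + s *\<^sub>R (B - A)) F + dist (P + s *\<^sub>R (B - A)) G = k"
    using confocal_level_two_points[OF nz(1) lt] by blast
  obtain r where r: "r > 0" "dist (P + r *\<^sub>R (A - B)) F + dist (P + r *\<^sub>R (A - B)) G = k"
    using confocal_level_two_points[OF nz(2) lt] by blast
  have hull: "P + v *\<^sub>R (B - A) \<in> affine hull {A, B}" for v
  proof -
    obtain w where "P = A + w *\<^sub>R (B - A)" using P(1) unfolding affine_hull_2_alt by auto
    hence "P + v *\<^sub>R (B - A) = A + (w + v) *\<^sub>R (B - A)" by (simp add: algebra_simps)
    thus ?thesis unfolding affine_hull_2_alt by blast
  qed
  have "P + s *\<^sub>R (B - A) = Q" using s hull[of s] assms(2) by blast
  moreover have "P + (- r) *\<^sub>R (B - A) = P + r *\<^sub>R (A - B)" by (simp add: algebra_simps)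
  hence "P + r *\<^sub>R (A - B) \<in> affine hull {A, B}" using hull[of "- r"] by simp
  hence "P + r *\<^sub>R (A - B) = Q" using r assms(2) by blast
  ultimately have "s *\<^sub>R (B - A) = r *\<^sub>R (A - B)" by (metis add_left_cancel)
  hence "(s + r) *\<^sub>R (B - A) = 0" by (simp add: algebra_simps)
  thus False using s r nz by auto
qed

text \<open>Among confocal ellipses only one touches a given line, so one tangent side determines the
  Brocard inellipse.\<close>

lemma brocard_inellipse_eqI:
  assumes nc: "A \<noteq> B"
    and E: "is_ellipse E (brocard_point1 A B C) (brocard_point2 A B C) a b"
    and t: "circumscribed_about A B C E"
  shows "brocard_inellipse A B C = E"
  unfolding brocard_inellipse_def
proof (rule the_equality)
  show "(\<exists>a b. is_ellipse E (brocard_point1 A B C) (brocard_point2 A B C) a b) \<and>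
      circumscribed_about A B C E"
    using E t by blast
next
  fix X assume "(\<exists>a b. is_ellipse X (brocard_point1 A B C) (brocard_point2 A B C) a b) \<and>
      circumscribed_about A B C X"
  then obtain a' b' where X: "is_ellipse X (brocard_point1 A B C) (brocard_point2 A B C) a' b'"
    and t': "circumscribed_about A B C X" by blast
  define F where "F = brocard_point1 A B C"
  define G where "G = brocard_point2 A B C"
  have E': "E = {P. dist P F + dist P G = 2 * a}" and X': "X = {P. dist P F + dist P G = 2 * a'}"
    using E X by (auto simp: is_ellipse_def F_def G_def)
  obtain Q where Q: "affine hull {A, B} \<inter> E = {Q}"
    using t by (auto simp: circumscribed_about_def side_tangent_def)
  obtain Q' where Q': "affine hull {A, B} \<inter> X = {Q'}"
    using t' by (auto simp: circumscribed_about_def side_tangent_def)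
  have "affine hull {A, B} \<inter> E \<noteq> {}" "affine hull {A, B} \<inter> X \<noteq> {}"
    unfolding Q Q' by simp_all
  hence "2 * a \<le> 2 * a'" "2 * a' \<le> 2 * a"
    using tangent_confocal_le[OF nc Q[unfolded E'], of "2 * a'"]
      tangent_confocal_le[OF nc Q'[unfolded X'], of "2 * a"]
    unfolding E'[symmetric] X'[symmetric] by blast+
  hence "a = a'" by simp
  thus "X = E" unfolding E' X' by simp
qed

section \<open>Exchanging two vertices of a triangle\<close>

lemma side_tangent_commute: "side_tangent A B E \<longleftrightarrow> side_tangent B A E"
  by (simp add: side_tangent_def closed_segment_commute insert_commute)

lemma circumscribed_about_swap: "circumscribed_about A B C E \<longleftrightarrow> circumscribed_about A C B E"
  by (auto simp: circumscribed_about_def side_tangent_commute)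

lemma is_ellipse_commute: "is_ellipse E F G a b \<longleftrightarrow> is_ellipse E G F a b"
  by (simp add: is_ellipse_def dist_commute add.commute)

lemma brocard_point1_swap: "brocard_point1 A C B = brocard_point2 A B C"
  by (simp only: brocard_point1_def brocard_point2_def is_brocard2_swap)

lemma brocard_point2_swap: "brocard_point2 A C B = brocard_point1 A B C"
  by (simp only: brocard_point1_def brocard_point2_def is_brocard2_swap)

lemma brocard_angle_swap: "brocard_angle A C B = brocard_angle A B C"
proof -
  have "(\<exists>P Q. is_brocard1 A C B P w \<and> is_brocard1 A B C Q w) \<longleftrightarrow>
      (\<exists>P Q. is_brocard1 A B C P w \<and> is_brocard1 A C B Q w)" for w
    by blast
  thus ?thesis by (simp only: brocard_angle_def is_brocard2_swap)
qed

lemma brocard_inellipse_swap: "brocard_inellipse A C B = brocard_inellipse A B C"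
proof -
  have 1: "is_ellipse X (brocard_point2 A B C) (brocard_point1 A B C) a b \<longleftrightarrow>
      is_ellipse X (brocard_point1 A B C) (brocard_point2 A B C) a b" for X a b
    by (rule is_ellipse_commute)
  have 2: "circumscribed_about A C B X \<longleftrightarrow> circumscribed_about A B C X" for X
    by (rule circumscribed_about_swap)
  show ?thesis
    unfolding brocard_inellipse_def brocard_point1_swap[of A C B] brocard_point2_swap[of A C B] 1 2 ..
qed

lemma circumcenter_swap: "circumcenter A C B = circumcenter A B C"
proof -
  have "dist X A = dist X C \<and> dist X C = dist X B \<longleftrightarrow> dist X A = dist X B \<and> dist X B = dist X C"
    for X by argo
  thus ?thesis by (simp only: circumcenter_def)
qed

lemma circumcircle_swap: "circumcircle A C B = circumcircle A B C"
  by (simp add: circumcircle_def circumradius_def circumcenter_swap)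

text \<open>The last hypothesis is Thales' description of the circle with diameter from O' to K. At
  K + x (V - K) its form is a positive multiple of x (x - p), with p belonging to P; the tangent
  case p = 0 gives P = K.\<close>

lemma foot_on_diametral_circle:
  fixes V K P :: complex
  assumes "V \<noteq> K" "P \<in> affine hull {V, K}" "inner (P - O') (V - K) = 0"
    "\<And>X. X \<in> S \<longleftrightarrow> inner (X - O') (X - K) = 0"
  shows "(THE P. affine hull {V, K} \<inter> S = {K, P}) = P"
proof -
  have "affine hull {V, K} \<inter> S = {K, P}"
  proof -
    obtain p where p: "P = K + p *\<^sub>R (V - K)"
      using assms(2) unfolding insert_commute[of V] affine_hull_2_alt by auto
    have n: "inner (V - K) (V - K) > 0" using assms(1) by simp
    have "X \<in> S \<longleftrightarrow> X = K \<or> X = P" if "X = K + x *\<^sub>R (V - K)" for X x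
    proof -
      have "inner (X - O') (X - K) = x * inner (X - O') (V - K)" using that by simp
      moreover have "X - O' = (P - O') + (x - p) *\<^sub>R (V - K)"
        unfolding that p by (simp add: algebra_simps)
      ultimately have "inner (X - O') (X - K) = x * ((x - p) * inner (V - K) (V - K))"
        using assms(3) by (simp only: inner_add_left inner_scaleR_left) simp
      hence "X \<in> S \<longleftrightarrow> x = 0 \<or> x = p" using assms(4) n by simp
      thus ?thesis using that p assms(1) by auto
    qed
    moreover have hull: "X \<in> affine hull {V, K} \<longleftrightarrow> (\<exists>x. X = K + x *\<^sub>R (V - K))" for X
      unfolding insert_commute[of V] affine_hull_2_alt by auto
    moreover have "K = K + 0 *\<^sub>R (V - K)" by simp
    hence "K \<in> affine hull {V, K}" using hull by blast
    ultimately show ?thesis using assms(2) by blast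
  qed
  thus ?thesis by (intro the_equality) (auto simp: doubleton_eq_iff)
qed

section \<open>Boosts of the Klein disc\<close>

text \<open>The last homogeneous coordinate after the Lorentz boost with cosh = (1 + t^2) / (1 -
  t^2) and sinh = 2 t / (1 - t^2), cleared of the denominator 1 - t^2. Thus t is the hyperbolic
  tangent of half the rapidity.\<close>

definition boost_weight :: "real \<Rightarrow> complex \<Rightarrow> real" where
  "boost_weight t z = 1 + t\<^sup>2 - 2 * t * Im z"

text \<open>The hyperbolic translation of the Klein disc that moves the centre to
  \<open>- (2 t / (1 + t\<^sup>2)) \<i>\<close>.\<close>

definition boost :: "real \<Rightarrow> complex \<Rightarrow> complex" where
  "boost t z = (1 / boost_weight t z) *\<^sub>R
     Complex ((1 - t\<^sup>2) * Re z) ((1 + t\<^sup>2) * Im z - 2 * t)"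

lemma norm_eq_1_iff: "norm (z :: complex) = 1 \<longleftrightarrow> (Re z)\<^sup>2 + (Im z)\<^sup>2 = 1"
  by (simp add: cmod_def)

lemma boost_weight_pos:
  assumes "\<bar>t\<bar> < 1" "norm z \<le> 1"
  shows "boost_weight t z > 0"
proof -
  have "\<bar>Im z\<bar> \<le> 1" using abs_Im_le_cmod[of z] assms by linarith
  hence "\<bar>t\<bar> * \<bar>Im z\<bar> \<le> \<bar>t\<bar> * 1" by (intro mult_left_mono) auto
  hence "t * Im z \<le> \<bar>t\<bar>" using abs_mult[of t "Im z"] by linarith
  moreover have "(1 - \<bar>t\<bar>)\<^sup>2 > 0" using assms by simp
  moreover have "(1 - \<bar>t\<bar>)\<^sup>2 = 1 + t\<^sup>2 - 2 * \<bar>t\<bar>" by (simp add: power2_diff)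
  ultimately show ?thesis by (simp add: boost_weight_def)
qed

lemma boost_weight_scaleR_boost:
  assumes "boost_weight t z \<noteq> 0"
  shows "boost_weight t z *\<^sub>R boost t z = Complex ((1 - t\<^sup>2) * Re z) ((1 + t\<^sup>2) * Im z - 2 * t)"
  using assms by (simp add: boost_def)

lemma Re_boost: "Re (boost t z) = (1 - t\<^sup>2) * Re z / boost_weight t z"
  and Im_boost: "Im (boost t z) = ((1 + t\<^sup>2) * Im z - 2 * t) / boost_weight t z"
  by (simp_all add: boost_def)

text \<open>In homogeneous coordinates the boost multiplies the Lorentz form by (1 - t^2)^2, so it
  maps the cone over the unit circle to itself.\<close>

lemma norm_boost:
  assumes "\<bar>t\<bar> < 1" "norm z = 1"
  shows "norm (boost t z) = 1"
proof -
  have w: "boost_weight t z > 0" using boost_weight_pos assms by simp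
  have z: "(Re z)\<^sup>2 + (Im z)\<^sup>2 = 1" using assms(2) norm_eq_1_iff by blast
  have "((1 - t\<^sup>2) * Re z)\<^sup>2 + ((1 + t\<^sup>2) * Im z - 2 * t)\<^sup>2 = (boost_weight t z)\<^sup>2"
    unfolding boost_weight_def using z by algebra
  thus ?thesis unfolding norm_eq_1_iff Re_boost Im_boost
    using w by (simp add: power_divide add_divide_distrib[symmetric])
qed

lemma boost_inverse:
  assumes "\<bar>t\<bar> < 1" "norm z = 1"
  shows "boost t (boost (- t) z) = z"
proof -
  have w: "boost_weight (- t) z > 0" using boost_weight_pos[of "- t" z] assms by simp
  have w2: "boost_weight t (boost (- t) z) = (1 - t\<^sup>2)\<^sup>2 / boost_weight (- t) z"
    using w unfolding boost_weight_def[of t] Im_boost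
    by (simp add: field_simps) (simp add: boost_weight_def power2_eq_square algebra_simps)
  have d: "1 - t\<^sup>2 \<noteq> 0" using assms(1) by (simp add: abs_square_eq_1)
  show ?thesis
  proof (rule complex_eqI)
    show "Re (boost t (boost (- t) z)) = Re z"
      unfolding Re_boost w2 using w d by (simp add: power2_eq_square)
    have "Im (boost t (boost (- t) z)) =
        ((1 + t\<^sup>2) * ((1 + t\<^sup>2) * Im z + 2 * t) - 2 * t * boost_weight (- t) z) / (1 - t\<^sup>2)\<^sup>2"
      unfolding Im_boost w2 using w d by (simp add: field_simps)
    also have "(1 + t\<^sup>2) * ((1 + t\<^sup>2) * Im z + 2 * t) - 2 * t * boost_weight (- t) z = (1 - t\<^sup>2)\<^sup>2 * Im z"
      by (simp add: boost_weight_def power2_eq_square algebra_simps)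
    finally show "Im (boost t (boost (- t) z)) = Im z" using d by simp
  qed
qed

text \<open>For unit vectors half the squared distance is 1 - inner u v, up to sign the Lorentz
  product of the null vectors (u, 1) and (v, 1). The linear map multiplies it by (1 - t^2)^2;
  normalising the last coordinates divides it by the two weights.\<close>

lemma dist_boost:
  assumes "\<bar>t\<bar> < 1" "norm u = 1" "norm v = 1"
  shows "(dist (boost t u) (boost t v))\<^sup>2 =
    (1 - t\<^sup>2)\<^sup>2 * (dist u v)\<^sup>2 / (boost_weight t u * boost_weight t v)"
proof -
  define p where "p = boost_weight t u"
  define q where "q = boost_weight t v"
  have pq: "p > 0" "q > 0" using boost_weight_pos assms by (simp_all add: p_def q_def)
  have p: "p = 1 + t\<^sup>2 - 2 * t * Im u" and q: "q = 1 + t\<^sup>2 - 2 * t * Im v"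
    by (simp_all add: p_def q_def boost_weight_def)
  have u: "(Re u)\<^sup>2 + (Im u)\<^sup>2 = 1" and v: "(Re v)\<^sup>2 + (Im v)\<^sup>2 = 1"
    using assms norm_eq_1_iff by blast+
  define n where "n z = (1 + t\<^sup>2) * Im z - 2 * t" for z
  have R: "Re (boost t u) - Re (boost t v) = (1 - t\<^sup>2) * (Re u * q - Re v * p) / (p * q)"
    using pq unfolding Re_boost p_def[symmetric] q_def[symmetric] by (simp add: field_simps)
  have "Im (boost t u) - Im (boost t v) = (n u * q - n v * p) / (p * q)"
    using pq unfolding Im_boost p_def[symmetric] q_def[symmetric] n_def[symmetric] by (simp add: field_simps)
  also have "n u * q - n v * p = (1 - t\<^sup>2)\<^sup>2 * (Im u - Im v)"
    unfolding n_def p q by algebra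
  finally have I: "Im (boost t u) - Im (boost t v) = (1 - t\<^sup>2)\<^sup>2 * (Im u - Im v) / (p * q)" .
  have "(Re u * q - Re v * p)\<^sup>2 + (1 - t\<^sup>2)\<^sup>2 * (Im u - Im v)\<^sup>2 =
      p * q * ((Re u - Re v)\<^sup>2 + (Im u - Im v)\<^sup>2)"
    unfolding p q using u v by algebra
  hence e: "(1 - t\<^sup>2)\<^sup>2 * ((Re u * q - Re v * p)\<^sup>2 + (1 - t\<^sup>2)\<^sup>2 * (Im u - Im v)\<^sup>2) =
      (1 - t\<^sup>2)\<^sup>2 * (p * q * ((Re u - Re v)\<^sup>2 + (Im u - Im v)\<^sup>2))" by simp
  have "(dist (boost t u) (boost t v))\<^sup>2 =
      ((1 - t\<^sup>2) * (Re u * q - Re v * p) / (p * q))\<^sup>2 + ((1 - t\<^sup>2)\<^sup>2 * (Im u - Im v) / (p * q))\<^sup>2"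
    unfolding dist_norm cmod_power2 minus_complex.sel R I ..
  also have "\<dots> = (1 - t\<^sup>2)\<^sup>2 * ((Re u * q - Re v * p)\<^sup>2 + (1 - t\<^sup>2)\<^sup>2 * (Im u - Im v)\<^sup>2) / (p * q)\<^sup>2"
    by (simp add: power_divide power_mult_distrib add_divide_distrib distrib_left power2_eq_square mult_ac)
  also have "\<dots> = (1 - t\<^sup>2)\<^sup>2 * ((Re u - Re v)\<^sup>2 + (Im u - Im v)\<^sup>2) / (p * q)"
    unfolding e using pq by (simp add: power2_eq_square)
  finally show ?thesis by (simp add: p_def q_def dist_norm cmod_power2)
qed

text \<open>The cross product is the determinant of the three points in homogeneous coordinates; (1
  - t^2)^3 is the determinant of the linear map, and the weights come from normalising.\<close>

lemma cross_boost:
  assumes "boost_weight t u \<noteq> 0" "boost_weight t v \<noteq> 0" "boost_weight t w \<noteq> 0"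
  shows "Im (cnj (boost t v - boost t u) * (boost t w - boost t u)) =
    (1 - t\<^sup>2) ^ 3 * Im (cnj (v - u) * (w - u)) / (boost_weight t u * boost_weight t v * boost_weight t w)"
proof -
  define p q r where pqr: "p = boost_weight t u" "q = boost_weight t v" "r = boost_weight t w"
  have nz: "p \<noteq> 0" "q \<noteq> 0" "r \<noteq> 0" using assms by (simp_all add: pqr)
  have p: "p = 1 + t\<^sup>2 - 2 * t * Im u" and q: "q = 1 + t\<^sup>2 - 2 * t * Im v" and r: "r = 1 + t\<^sup>2 - 2 * t * Im w"
    by (simp_all add: pqr boost_weight_def)
  define n where "n z = (1 + t\<^sup>2) * Im z - 2 * t" for z
  have id: "(x2 / q - x1 / p) * (y3 / r - y1 / p) - (y2 / q - y1 / p) * (x3 / r - x1 / p) =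
      (x1 * (y2 * r - y3 * q) + x2 * (y3 * p - y1 * r) + x3 * (y1 * q - y2 * p)) / (p * q * r)"
    for x1 x2 x3 y1 y2 y3 :: real
    using nz by (simp add: field_simps)
  have "Im (cnj (boost t v - boost t u) * (boost t w - boost t u)) =
      (Re (boost t v) - Re (boost t u)) * (Im (boost t w) - Im (boost t u)) -
      (Im (boost t v) - Im (boost t u)) * (Re (boost t w) - Re (boost t u))"
    by (simp add: algebra_simps)
  also have "\<dots> = ((1 - t\<^sup>2) * Re u * (n v * r - n w * q) + (1 - t\<^sup>2) * Re v * (n w * p - n u * r) +
      (1 - t\<^sup>2) * Re w * (n u * q - n v * p)) / (p * q * r)"
    unfolding Re_boost Im_boost pqr[symmetric] n_def[symmetric] by (rule id)
  also have "(1 - t\<^sup>2) * Re u * (n v * r - n w * q) + (1 - t\<^sup>2) * Re v * (n w * p - n u * r) +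
      (1 - t\<^sup>2) * Re w * (n u * q - n v * p) =
      (1 - t\<^sup>2) ^ 3 * ((Re v - Re u) * (Im w - Im u) - (Im v - Im u) * (Re w - Re u))"
    unfolding n_def p q r by algebra
  finally show ?thesis by (simp add: pqr algebra_simps)
qed

text \<open>The zero set is the image under \<^term>\<open>boost t\<close> of the circle of radius \<open>1/2\<close>.\<close>

definition inellipse_form :: "real \<Rightarrow> complex \<Rightarrow> real" where
  "inellipse_form t z = (1 - t\<^sup>2)\<^sup>2 * (Re z)\<^sup>2 + (1 + t\<^sup>2 + t ^ 4) * (Im z)\<^sup>2
     + 3 * t * (1 + t\<^sup>2) * Im z - (t ^ 4 - 14 * t\<^sup>2 + 1) / 4"

definition porism_ellipse :: "complex \<Rightarrow> real \<Rightarrow> real \<Rightarrow> complex set" where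
  "porism_ellipse c R t = {c + R *\<^sub>R z | z. inellipse_form t z = 0}"

text \<open>The first Brocard point of every counterclockwise orbit triangle, for center 0 and
  radius 1. Its mirror image in the y-axis, \<open>- cnj (focus t)\<close>, is the second.\<close>

definition focus :: "real \<Rightarrow> complex" where
  "focus t = Complex (sqrt 3 * t * (1 - t\<^sup>2) / (2 * (1 + t\<^sup>2 + t ^ 4)))
     (- (3 * t * (1 + t\<^sup>2) / (2 * (1 + t\<^sup>2 + t ^ 4))))"

lemma mem_porism_ellipse:
  assumes "R > 0"
  shows "c + R *\<^sub>R z \<in> porism_ellipse c R t \<longleftrightarrow> inellipse_form t z = 0"
  using assms by (auto simp: porism_ellipse_def)

text \<open>The point on the chord is the boost of the homogeneous vector (x, y, s), the combination
  of (u, 1) and (v, 1) with coefficients \<alpha> and \<beta>. There the form pulls back to the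
  circle 4 x^2 + 4 y^2 = s^2 of radius 1/2.\<close>

lemma inellipse_form_chord:
  assumes uv: "norm u = 1" "norm v = 1" and w: "boost_weight t u \<noteq> 0" "boost_weight t v \<noteq> 0"
    and ab: "\<alpha> = (1 - l) / boost_weight t u" "\<beta> = l / boost_weight t v"
  shows "inellipse_form t ((1 - l) *\<^sub>R boost t u + l *\<^sub>R boost t v) =
    (1 - t\<^sup>2) ^ 4 / 4 * (3 * \<alpha>\<^sup>2 + 3 * \<beta>\<^sup>2 + (8 * inner u v - 2) * \<alpha> * \<beta>)"
proof -
  define x y s where xys: "x = \<alpha> * Re u + \<beta> * Re v" "y = \<alpha> * Im u + \<beta> * Im v" "s = \<alpha> + \<beta>"
  have "\<alpha> * boost_weight t u + \<beta> * boost_weight t v = 1" using w by (simp add: ab)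
  hence 1: "(1 + t\<^sup>2) * s - 2 * t * y = 1" by (simp add: xys boost_weight_def algebra_simps)
  define k where "k = (1 + t\<^sup>2) * s - 2 * t * y"
  define Y where "Y = (1 + t\<^sup>2) * y - 2 * t * s"
  have R: "Re ((1 - l) *\<^sub>R boost t u + l *\<^sub>R boost t v) = (1 - t\<^sup>2) * x"
    by (simp add: Re_boost xys ab distrib_left mult_ac)
  have "Im ((1 - l) *\<^sub>R boost t u + l *\<^sub>R boost t v) =
      \<alpha> * ((1 + t\<^sup>2) * Im u - 2 * t) + \<beta> * ((1 + t\<^sup>2) * Im v - 2 * t)"
    by (simp add: Im_boost ab)
  also have "\<dots> = Y" by (simp add: xys Y_def algebra_simps)
  finally have I: "Im ((1 - l) *\<^sub>R boost t u + l *\<^sub>R boost t v) = Y" .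
  \<comment> \<open>Inserting k = 1 makes the form homogeneous of degree 2 in x, y, s, so the
    pullback becomes a polynomial identity.\<close>
  have "inellipse_form t ((1 - l) *\<^sub>R boost t u + l *\<^sub>R boost t v) =
      (1 - t\<^sup>2)\<^sup>2 * ((1 - t\<^sup>2) * x)\<^sup>2 + (1 + t\<^sup>2 + t ^ 4) * Y\<^sup>2
        + 3 * t * (1 + t\<^sup>2) * Y * k - (t ^ 4 - 14 * t\<^sup>2 + 1) / 4 * k\<^sup>2"
    unfolding inellipse_form_def R I using 1 by (simp add: k_def)
  also have "\<dots> = (1 - t\<^sup>2) ^ 4 / 4 * (4 * x\<^sup>2 + 4 * y\<^sup>2 - s\<^sup>2)"
  proof -
    have "4 * ((1 - t\<^sup>2)\<^sup>2 * ((1 - t\<^sup>2) * x)\<^sup>2 + (1 + t\<^sup>2 + t ^ 4) * Y\<^sup>2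
        + 3 * t * (1 + t\<^sup>2) * Y * k) - (t ^ 4 - 14 * t\<^sup>2 + 1) * k\<^sup>2 = (1 - t\<^sup>2) ^ 4 * (4 * x\<^sup>2 + 4 * y\<^sup>2 - s\<^sup>2)"
      unfolding Y_def k_def by algebra
    thus ?thesis by (simp add: field_simps)
  qed
  also have "4 * x\<^sup>2 + 4 * y\<^sup>2 - s\<^sup>2 = 3 * \<alpha>\<^sup>2 + 3 * \<beta>\<^sup>2 + (8 * inner u v - 2) * \<alpha> * \<beta>"
    using uv unfolding xys norm_eq_1_iff inner_complex_def by algebra
  finally show ?thesis .
qed

text \<open>Completing the square in Im z puts the center at height -h and shows the semi-axes; the
  focal distance f then comes from m - (1 - t^2)^2 = 3 t^2.\<close>

lemma porism_ellipse_is_ellipse: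
  assumes t: "0 < t" "t < 1" and R: "R > 0" and m: "m = 1 + t\<^sup>2 + t ^ 4"
  shows "is_ellipse (porism_ellipse c R t) (c + R *\<^sub>R focus t) (c + R *\<^sub>R (- cnj (focus t)))
    (R * ((1 - t\<^sup>2) / (2 * sqrt m))) (R * ((1 - t\<^sup>2)\<^sup>2 / (2 * m)))"
proof -
  define d where "d = 1 - t\<^sup>2"
  define h where "h = 3 * t * (1 + t\<^sup>2) / (2 * m)"
  define f where "f = sqrt 3 * t * d / (2 * m)"
  define a where "a = d / (2 * sqrt m)"
  define b where "b = d\<^sup>2 / (2 * m)"
  have m0: "m > 0" using t by (simp add: m add_pos_pos)
  have d0: "d > 0" using t by (simp add: d_def power_less_one_iff)
  have md: "m - d\<^sup>2 = 3 * t\<^sup>2" unfolding m d_def by algebra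
  have a2: "a\<^sup>2 = d\<^sup>2 / (4 * m)" using m0 by (simp add: a_def power_divide power_mult_distrib)
  have b2: "b\<^sup>2 = d ^ 4 / (4 * m\<^sup>2)" by (simp add: b_def power_divide power_mult_distrib flip: power_mult)
  have f2: "f\<^sup>2 = 3 * t\<^sup>2 * d\<^sup>2 / (4 * m\<^sup>2)" by (simp add: f_def power_divide power_mult_distrib)
  have "a\<^sup>2 - b\<^sup>2 = d\<^sup>2 * (m - d\<^sup>2) / (4 * m\<^sup>2)"
    using m0 unfolding a2 b2 by (simp add: field_simps power2_eq_square power4_eq_xxxx)
  hence fab: "f\<^sup>2 = a\<^sup>2 - b\<^sup>2" unfolding f2 md by simp
  have a0: "a > 0" and b0: "b > 0" using m0 d0 by (simp_all add: a_def b_def)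
  have "b\<^sup>2 \<le> a\<^sup>2" using fab zero_le_power2[of f] by linarith
  hence ba: "b \<le> a" using a0 by (simp add: power2_le_iff_abs_le b0 less_imp_le)
  have foc: "focus t = Complex f (- h)" by (simp add: focus_def f_def h_def m d_def)
  have foc': "- cnj (focus t) = Complex (- f) (- h)" by (simp add: foc complex_eq_iff)
  have "{P. dist P (c + R *\<^sub>R focus t) + dist P (c + R *\<^sub>R (- cnj (focus t))) = 2 * (R * a)} = porism_ellipse c R t"
  proof (rule set_eqI)
    fix P
    define z where "z = (1 / R) *\<^sub>R (P - c)"
    have P: "P = c + R *\<^sub>R z" using R by (simp add: z_def)
    have sc: "dist P (c + R *\<^sub>R w) = R * dist z w" for w
      using R by (simp add: P dist_norm flip: scaleR_diff_right)
    have sh: "dist z (Complex k (- h)) = dist (z + Complex 0 h) (Complex k 0)" for k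
      by (simp add: dist_norm complex_eq_iff cmod_def)
    have "P \<in> {P. dist P (c + R *\<^sub>R focus t) + dist P (c + R *\<^sub>R (- cnj (focus t))) = 2 * (R * a)} \<longleftrightarrow>
        R * (dist z (Complex f (- h)) + dist z (Complex (- f) (- h))) = R * (2 * a)"
      unfolding mem_Collect_eq sc foc' unfolding foc by (simp only: distrib_left mult_ac)
    also have "\<dots> \<longleftrightarrow> dist (z + Complex 0 h) (Complex f 0) + dist (z + Complex 0 h) (Complex (- f) 0) = 2 * a"
      using R unfolding sh by simp
    also have "\<dots> \<longleftrightarrow> (Re z)\<^sup>2 / a\<^sup>2 + (Im z + h)\<^sup>2 / b\<^sup>2 = 1"
      using ellipse_eq_quadric[OF b0 ba fab, of "z + Complex 0 h"] by simp
    also have "\<dots> \<longleftrightarrow> 4 * m * (d\<^sup>2 * (Re z)\<^sup>2 + m * (Im z + h)\<^sup>2) = d ^ 4"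
      using m0 d0 unfolding a2 b2
      by (simp add: field_simps power2_eq_square power4_eq_xxxx) (rule eq_commute)
    also have "4 * m * (d\<^sup>2 * (Re z)\<^sup>2 + m * (Im z + h)\<^sup>2) =
        4 * m * d\<^sup>2 * (Re z)\<^sup>2 + (2 * m * Im z + 2 * m * h)\<^sup>2" by algebra
    also have "2 * m * h = 3 * t * (1 + t\<^sup>2)" using m0 by (simp add: h_def)
    also have "4 * m * d\<^sup>2 * (Re z)\<^sup>2 + (2 * m * Im z + 3 * t * (1 + t\<^sup>2))\<^sup>2 = d ^ 4 \<longleftrightarrow>
        4 * m * inellipse_form t z = 0"
    proof -
      have "4 * m * d\<^sup>2 * (Re z)\<^sup>2 + (2 * m * Im z + 3 * t * (1 + t\<^sup>2))\<^sup>2 - d ^ 4 =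
        4 * m * d\<^sup>2 * (Re z)\<^sup>2 + 4 * m * (m * (Im z)\<^sup>2) + 4 * m * (3 * t * (1 + t\<^sup>2) * Im z) - m * (t ^ 4 - 14 * t\<^sup>2 + 1)"
        unfolding m d_def by algebra
      also have "\<dots> = m * (4 * inellipse_form t z)"
      proof -
        define e where "e = t ^ 4 - 14 * t\<^sup>2 + 1"
        have f: "4 * inellipse_form t z = 4 * (d\<^sup>2 * (Re z)\<^sup>2) + 4 * (m * (Im z)\<^sup>2) + 4 * (3 * t * (1 + t\<^sup>2) * Im z) - e"
          unfolding inellipse_form_def d_def m e_def[symmetric] by (simp only: right_diff_distrib distrib_left)
        show ?thesis unfolding f e_def[symmetric] by (simp add: algebra_simps)
      qed
      finally show ?thesis by auto
    qed
    also have "\<dots> \<longleftrightarrow> P \<in> porism_ellipse c R t"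
      unfolding P mem_porism_ellipse[OF R] using m0 by simp
    finally show "P \<in> {P. dist P (c + R *\<^sub>R focus t) + dist P (c + R *\<^sub>R (- cnj (focus t))) = 2 * (R * a)}
        \<longleftrightarrow> P \<in> porism_ellipse c R t" .
  qed
  moreover have "(dist (c + R *\<^sub>R focus t) (c + R *\<^sub>R (- cnj (focus t))) / 2)\<^sup>2 = (R * a)\<^sup>2 - (R * b)\<^sup>2"
  proof -
    have "dist (c + R *\<^sub>R focus t) (c + R *\<^sub>R (- cnj (focus t))) = norm (R *\<^sub>R (focus t + cnj (focus t)))"
      by (simp add: dist_norm scaleR_add_right)
    also have "focus t + cnj (focus t) = of_real (2 * f)" by (simp add: foc complex_eq_iff)
    finally have "dist (c + R *\<^sub>R focus t) (c + R *\<^sub>R (- cnj (focus t))) = 2 * (R * \<bar>f\<bar>)"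
      using R by simp
    thus ?thesis using fab by (simp add: power_mult_distrib right_diff_distrib)
  qed
  ultimately show ?thesis
    unfolding is_ellipse_def a_def[symmetric] b_def[symmetric] d_def[symmetric]
    using R a0 b0 ba by simp
qed

section \<open>The porism as an orbit of equilateral triangles\<close>

definition porism_vertex :: "complex \<Rightarrow> real \<Rightarrow> real \<Rightarrow> complex \<Rightarrow> complex" where
  "porism_vertex c R t z = c + R *\<^sub>R boost t z"

definition rot :: complex where
  "rot = Complex (- 1 / 2) (sqrt 3 / 2)"

lemma rot_mult:
  "Re (rot * u) = - Re u / 2 - sqrt 3 / 2 * Im u"
  "Im (rot * u) = sqrt 3 / 2 * Re u - Im u / 2"
  "Re (cnj rot * u) = - Re u / 2 + sqrt 3 / 2 * Im u"
  "Im (cnj rot * u) = - (sqrt 3 / 2 * Re u) - Im u / 2"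
  by (simp_all add: rot_def)

lemma norm_rot [simp]: "norm rot = 1"
  by (simp add: rot_def cmod_def power_divide)

lemma inner_rot:
  assumes "norm u = 1"
  shows "inner u (rot * u) = - 1 / 2" "inner (rot * u) (cnj rot * u) = - 1 / 2"
    "inner (cnj rot * u) u = - 1 / 2"
proof -
  have u: "(Re u)\<^sup>2 + (Im u)\<^sup>2 = 1" using assms norm_eq_1_iff by blast
  have h: "(sqrt 3)\<^sup>2 = (3 :: real)" by simp
  show "inner u (rot * u) = - 1 / 2" "inner (rot * u) (cnj rot * u) = - 1 / 2"
    "inner (cnj rot * u) u = - 1 / 2"
    unfolding inner_complex_def rot_mult using u h
    by (simp_all add: field_simps) algebra+
qed

text \<open>By Vieta -b/a - x0 is a root as well, hence equal to x0.\<close>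

lemma quadratic_unique_root_discrim:
  fixes a b c :: real
  assumes "a \<noteq> 0" "\<And>x. a * x\<^sup>2 + b * x + c = 0 \<longleftrightarrow> x = x0"
  shows "b\<^sup>2 = 4 * a * c"
proof -
  have r: "a * x0\<^sup>2 + b * x0 + c = 0" using assms(2) by blast
  define x1 where "x1 = - b / a - x0"
  have x1: "a * x1 = - b - a * x0" using assms(1) by (simp add: x1_def algebra_simps)
  have "a * (a * x1\<^sup>2 + b * x1 + c) = 0" using x1 r by algebra
  hence "x1 = x0" using assms by simp
  hence "2 * a * x0 = - b" using x1 by simp
  thus ?thesis using r by algebra
qed

section \<open>Tangent sides in terms of the unit preimages\<close>

lemma porism_vertex_line:
  "(1 - l) *\<^sub>R porism_vertex c R t u + l *\<^sub>R porism_vertex c R t v =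
    c + R *\<^sub>R ((1 - l) *\<^sub>R boost t u + l *\<^sub>R boost t v)"
  by (simp add: porism_vertex_def algebra_simps)

lemma dist_porism_vertex:
  assumes "R > 0" "\<bar>t\<bar> < 1" "norm v = 1" "norm w = 1"
  shows "(dist (porism_vertex c R t v) (porism_vertex c R t w))\<^sup>2 =
    R\<^sup>2 * (1 - t\<^sup>2)\<^sup>2 * (dist v w)\<^sup>2 / (boost_weight t v * boost_weight t w)"
proof -
  have "dist (porism_vertex c R t v) (porism_vertex c R t w) = R * dist (boost t v) (boost t w)"
    using assms(1) by (simp add: porism_vertex_def dist_norm flip: scaleR_diff_right)
  thus ?thesis using dist_boost[OF assms(2-4)] by (simp add: power_mult_distrib)
qed

lemma boost_weight_scaleR_porism_vertex:
  assumes "boost_weight t z > 0"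
  shows "boost_weight t z *\<^sub>R porism_vertex c R t z = boost_weight t z *\<^sub>R c +
    R *\<^sub>R Complex ((1 - t\<^sup>2) * Re z) ((1 + t\<^sup>2) * Im z - 2 * t)"
  using boost_weight_scaleR_boost[of t z] assms
  unfolding porism_vertex_def scaleR_add_right scaleR_left_commute[of _ R] by simp

lemma affine_hull_2_param:
  "affine hull {A, B} = range (\<lambda>l. (1 - l) *\<^sub>R A + l *\<^sub>R B)"
  unfolding affine_hull_2_alt by (simp add: algebra_simps)

text \<open>For inner product -1/2 the form on the chord is a multiple of the perfect square
  (\<alpha> - \<beta>)^2, so it has one double zero.\<close>

lemma side_tangent_porism:
  assumes R: "R > 0" and t: "\<bar>t\<bar> < 1" and uv: "norm u = 1" "norm v = 1" "inner u v = - 1 / 2"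
  shows "side_tangent (porism_vertex c R t u) (porism_vertex c R t v) (porism_ellipse c R t)"
proof -
  define p q where pq: "p = boost_weight t u" "q = boost_weight t v"
  have pos: "p > 0" "q > 0" using boost_weight_pos t uv by (simp_all add: pq)
  have "1 - t\<^sup>2 > 0" using t by (simp add: abs_square_less_1)
  hence d: "(1 - t\<^sup>2) ^ 4 > 0" by simp
  \<comment> \<open>The solution of \<alpha> = \<beta>: the point of contact is the boosted midpoint
    of u and v. Positive weights put it on the segment.\<close>
  define l0 where "l0 = q / (p + q)"
  define P where "P l = (1 - l) *\<^sub>R porism_vertex c R t u + l *\<^sub>R porism_vertex c R t v" for l
  have mem: "P l \<in> porism_ellipse c R t \<longleftrightarrow> l = l0" for l
  proof -
    define \<alpha> \<beta> where ab: "\<alpha> = (1 - l) / p" "\<beta> = l / q"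
    have "3 * \<alpha>\<^sup>2 + 3 * \<beta>\<^sup>2 + (8 * inner u v - 2) * \<alpha> * \<beta> = 3 * (\<alpha> - \<beta>)\<^sup>2"
      unfolding uv(3) by (simp add: power2_eq_square algebra_simps)
    hence eq: "inellipse_form t ((1 - l) *\<^sub>R boost t u + l *\<^sub>R boost t v) =
        (1 - t\<^sup>2) ^ 4 / 4 * (3 * (\<alpha> - \<beta>)\<^sup>2)"
      using inellipse_form_chord[OF uv(1,2), of t \<alpha> l \<beta>] pos by (simp only: pq ab)
    have "P l \<in> porism_ellipse c R t \<longleftrightarrow> (1 - l) / p - l / q = 0"
      unfolding P_def porism_vertex_line mem_porism_ellipse[OF R] eq using d by (simp add: ab)
    also have "\<dots> \<longleftrightarrow> l = l0" using pos by (auto simp: l0_def field_simps)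
    finally show ?thesis .
  qed
  have "affine hull {porism_vertex c R t u, porism_vertex c R t v} \<inter> porism_ellipse c R t = {P l0}"
    unfolding affine_hull_2_param P_def[symmetric] by (auto simp: mem)
  moreover have "P l0 \<in> closed_segment (porism_vertex c R t u) (porism_vertex c R t v)"
    unfolding closed_segment_def P_def using pos by (intro CollectI exI[of _ l0]) (simp add: l0_def)
  ultimately show ?thesis unfolding side_tangent_def by blast
qed

text \<open>The ellipse cuts the line of the chord where a quadratic in l vanishes, with
  discriminant 4 (p q)^2 (e^2 - 9). Tangency makes it zero, and since u and v differ, e < 3, which
  leaves e = -3.\<close>

lemma side_tangent_porismD:
  assumes R: "R > 0" and t: "\<bar>t\<bar> < 1" and uv: "norm u = 1" "norm v = 1" "u \<noteq> v"
    and tan: "side_tangent (porism_vertex c R t u) (porism_vertex c R t v) (porism_ellipse c R t)"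
  shows "inner u v = - 1 / 2"
proof -
  define p q e where pq: "p = boost_weight t u" "q = boost_weight t v" and e: "e = 4 * inner u v - 1"
  have pos: "p > 0" "q > 0" using boost_weight_pos t uv by (simp_all add: pq)
  have d: "1 - t\<^sup>2 > 0" using t by (simp add: abs_square_less_1)
  have "inner (u - v) (u - v) > 0" using uv(3) by simp
  hence "inner u v < 1" using uv(1,2)
    by (simp add: inner_diff_left inner_diff_right inner_commute norm_eq_1)
  hence e3: "e < 3" by (simp add: e)
  define P where "P l = (1 - l) *\<^sub>R porism_vertex c R t u + l *\<^sub>R porism_vertex c R t v" for l
  have mem: "P l \<in> porism_ellipse c R t \<longleftrightarrow>
      (3 * p\<^sup>2 + 3 * q\<^sup>2 - 2 * e * p * q) * l\<^sup>2 + (2 * e * p * q - 6 * q\<^sup>2) * l + 3 * q\<^sup>2 = 0" for l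
  proof -
    define \<alpha> \<beta> where ab: "\<alpha> = (1 - l) / p" "\<beta> = l / q"
    have "inellipse_form t ((1 - l) *\<^sub>R boost t u + l *\<^sub>R boost t v) =
        (1 - t\<^sup>2) ^ 4 / 4 * (3 * \<alpha>\<^sup>2 + 3 * \<beta>\<^sup>2 + 2 * e * \<alpha> * \<beta>)"
      using inellipse_form_chord[OF uv(1,2), of t \<alpha> l \<beta>] pos
      by (simp add: pq ab e)
    note eq = this
    have "P l \<in> porism_ellipse c R t \<longleftrightarrow> (p * q)\<^sup>2 * (3 * \<alpha>\<^sup>2 + 3 * \<beta>\<^sup>2 + 2 * e * \<alpha> * \<beta>) = 0"
      unfolding P_def porism_vertex_line mem_porism_ellipse[OF R] eq using d pos by simp
    also have "(p * q)\<^sup>2 * (3 * \<alpha>\<^sup>2 + 3 * \<beta>\<^sup>2 + 2 * e * \<alpha> * \<beta>) =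
        3 * q\<^sup>2 * (p * \<alpha>)\<^sup>2 + 3 * p\<^sup>2 * (q * \<beta>)\<^sup>2 + 2 * e * p * q * (p * \<alpha>) * (q * \<beta>)"
      by algebra
    also have "p * \<alpha> = 1 - l" using pos by (simp add: ab)
    also have "q * \<beta> = l" using pos by (simp add: ab)
    also have "3 * q\<^sup>2 * (1 - l)\<^sup>2 + 3 * p\<^sup>2 * l\<^sup>2 + 2 * e * p * q * (1 - l) * l =
       (3 * p\<^sup>2 + 3 * q\<^sup>2 - 2 * e * p * q) * l\<^sup>2 + (2 * e * p * q - 6 * q\<^sup>2) * l + 3 * q\<^sup>2"
      by algebra
    finally show ?thesis .
  qed
  obtain Q where Q: "affine hull {porism_vertex c R t u, porism_vertex c R t v} \<inter> porism_ellipse c R t = {Q}"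
    using tan unfolding side_tangent_def by blast
  have hull: "affine hull {porism_vertex c R t u, porism_vertex c R t v} = range P"
    unfolding affine_hull_2_param P_def ..
  obtain l0 where l0: "Q = P l0" using Q hull by blast
  have inj: "l = l0" if "P l = P l0" for l
  proof -
    have "(l - l0) *\<^sub>R (porism_vertex c R t v - porism_vertex c R t u) = 0"
      using that by (simp add: P_def algebra_simps)
    moreover have "porism_vertex c R t v \<noteq> porism_vertex c R t u"
    proof
      assume "porism_vertex c R t v = porism_vertex c R t u"
      hence "boost t u = boost t v" using R by (simp add: porism_vertex_def)
      hence "(1 - t\<^sup>2)\<^sup>2 * (dist u v)\<^sup>2 / (p * q) = 0"
        using dist_boost[OF t uv(1,2)] by (simp add: pq)
      thus False using d pos uv(3) by simp
    qed
    ultimately show "l = l0" by simp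
  qed
  have "P l \<in> porism_ellipse c R t \<longleftrightarrow> l = l0" for l
    using Q hull l0 inj by blast
  note uniq = this[unfolded mem]
  have "3 * p\<^sup>2 + 3 * q\<^sup>2 - 2 * e * p * q = 3 * (p - q)\<^sup>2 + 2 * (3 - e) * (p * q)" by algebra
  also have "\<dots> > 0" using pos e3 by (intro add_nonneg_pos) auto
  finally have "3 * p\<^sup>2 + 3 * q\<^sup>2 - 2 * e * p * q \<noteq> 0" by simp
  from quadratic_unique_root_discrim[OF this uniq]
  have "4 * (p * q)\<^sup>2 * ((e - 3) * (e + 3)) = 0" by algebra
  hence "e = - 3" using pos e3 by simp
  thus ?thesis by (simp add: e)
qed

text \<open>The quotient v / u, written v * cnj u, is a root of z^2 + z + 1.\<close>

lemma equilateral_units: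
  assumes "norm u = 1" "norm v = 1" "norm w = 1" "u + v + w = 0"
  shows "v = rot * u \<and> w = cnj rot * u \<or> v = cnj rot * u \<and> w = rot * u"
proof -
  have u: "u * cnj u = 1" using assms(1) by (simp add: complex_norm_square[symmetric])
  have v: "v * cnj v = 1" using assms(2) by (simp add: complex_norm_square[symmetric])
  have w: "(- u - v) * cnj (- u - v) = 1"
    using assms(3,4) by (metis complex_norm_square add.commute add_diff_cancel_right' add_eq_0_iff diff_0 minus_diff_eq of_real_1 one_power2 minus_add_distrib uminus_add_conv_diff)
  have "u * cnj v + v * cnj u + 1 = 0" using u v w by (simp add: algebra_simps)
  have "(v * cnj u)\<^sup>2 + v * cnj u + 1 = 0"
    using u v \<open>u * cnj v + v * cnj u + 1 = 0\<close> by algebra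
  moreover have "rot + cnj rot = -1" "rot * cnj rot = 1"
    by (simp_all add: rot_def complex_eq_iff power2_eq_square)
  ultimately have "(v * cnj u - rot) * (v * cnj u - cnj rot) = 0" by algebra
  hence "v * cnj u = rot \<or> v * cnj u = cnj rot" by auto
  moreover have "v = (v * cnj u) * u" using u by (simp add: mult_ac)
  ultimately have "v = rot * u \<or> v = cnj rot * u" by metis
  moreover have "w = - u - v" using assms(4) by (simp add: eq_neg_iff_add_eq_0 algebra_simps)
  ultimately show ?thesis using \<open>rot + cnj rot = -1\<close> by algebra
qed

text \<open>One triangle of an orbit. Center and radius stay free because the locale serves T,
  around 0 with parameter t, as well as T', around another center with parameter t^2. The chosen
  order of the units makes the triangle counterclockwise (\<open>cross_pos\<close>).\<close>

locale porism_triangle =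
  fixes c :: complex and R t :: real and u :: complex
  assumes R: "R > 0" and t: "0 < t" "t < 1" and u: "norm u = 1"
begin

definition "A = porism_vertex c R t u"
definition "B = porism_vertex c R t (rot * u)"
definition "C = porism_vertex c R t (cnj rot * u)"
definition "p = boost_weight t u"
definition "q = boost_weight t (rot * u)"
definition "r = boost_weight t (cnj rot * u)"
definition "m = 1 + t\<^sup>2 + t ^ 4"
definition "K = c + R *\<^sub>R Complex 0 (- (2 * t / (1 + t\<^sup>2)))"

lemma abs_t: "\<bar>t\<bar> < 1" using t by simp

lemma norm_units: "norm u = 1" "norm (rot * u) = 1" "norm (cnj rot * u) = 1"
  using u by (simp_all add: norm_mult)

lemma pqr_pos: "p > 0" "q > 0" "r > 0"
  using boost_weight_pos[OF abs_t] norm_units by (simp_all add: p_def q_def r_def)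

lemma d_pos: "1 - t\<^sup>2 > 0" and m_pos: "m > 0"
  using t by (simp_all add: power_less_one_iff m_def add_pos_pos)

lemma sq: "(Re u)\<^sup>2 + (Im u)\<^sup>2 = 1" "(sqrt 3)\<^sup>2 = (3 :: real)"
  using u norm_eq_1_iff by auto

lemma pqr_eq:
  "p = 1 + t\<^sup>2 - 2 * t * Im u"
  "2 * q = 2 * (1 + t\<^sup>2) - 2 * t * (sqrt 3 * Re u - Im u)"
  "2 * r = 2 * (1 + t\<^sup>2) + 2 * t * (sqrt 3 * Re u + Im u)"
  unfolding p_def q_def r_def boost_weight_def rot_mult by (simp_all add: algebra_simps)

text \<open>The three units sum to zero, so their imaginary parts drop out. Together with
  \<open>sum_weight_products\<close> this is the independence of u behind the constancy of the
  invariants.\<close>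

lemma sum_weights: "p + q + r = 3 * (1 + t\<^sup>2)"
proof -
  have "2 * (p + q + r) = 2 * p + 2 * q + 2 * r" by simp
  also have "\<dots> = 2 * (3 * (1 + t\<^sup>2))" unfolding pqr_eq by (simp add: algebra_simps)
  finally show ?thesis by simp
qed

lemma sum_weight_products: "r * p + p * q + q * r = 3 * m"
proof -
  have "4 * (r * p + p * q + q * r) = 2 * p * (2 * r) + 2 * p * (2 * q) + (2 * q) * (2 * r)" by algebra
  \<comment> \<open>The last summand is zero. It is kept so that the equation is a polynomial
    identity with Re u, Im u and sqrt 3 as free variables; the same device returns for the Brocard
    points.\<close>
  also have "\<dots> = 12 * (1 + t\<^sup>2)\<^sup>2 - 12 * t\<^sup>2 * ((Re u)\<^sup>2 + (Im u)\<^sup>2) + 4 * t\<^sup>2 * (Re u)\<^sup>2 * (3 - (sqrt 3)\<^sup>2)"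
    unfolding pqr_eq by algebra
  also have "\<dots> = 4 * (3 * m)" unfolding sq m_def by algebra
  finally show ?thesis by simp
qed

lemma scaled_vertices:
  "p *\<^sub>R A = p *\<^sub>R c + R *\<^sub>R Complex ((1 - t\<^sup>2) * Re u) ((1 + t\<^sup>2) * Im u - 2 * t)"
  "q *\<^sub>R B = q *\<^sub>R c + R *\<^sub>R Complex ((1 - t\<^sup>2) * Re (rot * u)) ((1 + t\<^sup>2) * Im (rot * u) - 2 * t)"
  "r *\<^sub>R C = r *\<^sub>R c + R *\<^sub>R Complex ((1 - t\<^sup>2) * Re (cnj rot * u)) ((1 + t\<^sup>2) * Im (cnj rot * u) - 2 * t)"
  using boost_weight_scaleR_porism_vertex[of t _ c R] pqr_pos
  by (simp_all only: p_def q_def r_def A_def B_def C_def)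

text \<open>The common factor of the squared sides: the side opposite to A lacks p in its
  denominator, so its square is proportional to p.\<close>

definition "g = 3 * R\<^sup>2 * (1 - t\<^sup>2)\<^sup>2 / (p * q * r)"

lemma g_pos: "g > 0"
  using R d_pos pqr_pos by (simp add: g_def)

lemma side_lengths: "g * p = (dist B C)\<^sup>2" "g * q = (dist C A)\<^sup>2" "g * r = (dist A B)\<^sup>2"
proof -
  have *: "(dist (porism_vertex c R t v) (porism_vertex c R t w))\<^sup>2 =
      R\<^sup>2 * (1 - t\<^sup>2)\<^sup>2 * 3 / (boost_weight t v * boost_weight t w)"
    if "norm v = 1" "norm w = 1" "inner v w = - 1 / 2" for v w
  proof -
    have "(dist v w)\<^sup>2 = 3"
      using that by (simp add: dist_norm power2_norm_eq_inner inner_diff_left inner_diff_right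
          inner_commute norm_eq_1)
    thus ?thesis using dist_porism_vertex[OF R abs_t that(1,2)] by simp
  qed
  show "g * p = (dist B C)\<^sup>2" "g * q = (dist C A)\<^sup>2" "g * r = (dist A B)\<^sup>2"
    unfolding A_def B_def C_def
    using *[OF norm_units(2,3) inner_rot(2)[OF u]] *[OF norm_units(3,1) inner_rot(3)[OF u]]
      *[OF norm_units(1,2) inner_rot(1)[OF u]] pqr_pos
    unfolding p_def[symmetric] q_def[symmetric] r_def[symmetric] g_def
    by (simp_all add: mult_ac)
qed

lemma cross_eq:
  "Im (cnj (B - A) * (C - A)) = R\<^sup>2 * (1 - t\<^sup>2) ^ 3 * (3 * sqrt 3 / 2) / (p * q * r)"
proof -
  have "Im (cnj (rot * u - u) * (cnj rot * u - u)) = 3 * sqrt 3 / 2 * ((Re u)\<^sup>2 + (Im u)\<^sup>2)"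
    by (simp add: rot_def field_simps power2_eq_square)
  hence e: "Im (cnj (rot * u - u) * (cnj rot * u - u)) = 3 * sqrt 3 / 2" using sq by simp
  have "B - A = R *\<^sub>R (boost t (rot * u) - boost t u)" "C - A = R *\<^sub>R (boost t (cnj rot * u) - boost t u)"
    by (simp_all add: A_def B_def C_def porism_vertex_def scaleR_diff_right)
  moreover have "Im (cnj (R *\<^sub>R a) * (R *\<^sub>R b)) = R\<^sup>2 * Im (cnj a * b)" for a b
    by (simp add: power2_eq_square algebra_simps)
  ultimately have "Im (cnj (B - A) * (C - A)) =
      R\<^sup>2 * Im (cnj (boost t (rot * u) - boost t u) * (boost t (cnj rot * u) - boost t u))"
    by (simp only:)
  also have "\<dots> = R\<^sup>2 * ((1 - t\<^sup>2) ^ 3 * (3 * sqrt 3 / 2) / (p * q * r))"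
    using cross_boost[of t u "rot * u" "cnj rot * u"] pqr_pos
    unfolding e p_def[symmetric] q_def[symmetric] r_def[symmetric] by simp
  finally show ?thesis by simp
qed

lemma cross_pos: "Im (cnj (B - A) * (C - A)) > 0"
  unfolding cross_eq using R d_pos pqr_pos by simp

lemma noncollinear: "\<not> collinear {A, B, C}"
  unfolding noncollinear_iff using cross_pos by simp

lemma dist_center: "dist c A = R" "dist c B = R" "dist c C = R"
  using R norm_boost[OF abs_t] norm_units
  by (simp_all add: A_def B_def C_def porism_vertex_def dist_norm)

lemma circumcenter: "circumcenter A B C = c"
  by (rule circumcenter_eqI[OF noncollinear]) (simp_all add: dist_center)

lemma circumradius: "circumradius A B C = R"
  by (simp add: circumradius_def circumcenter dist_center)

lemma circumcircle: "circumcircle A B C = sphere c R"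
  by (simp add: circumcircle_def circumradius circumcenter)

text \<open>The weight p clears the denominator of A, so the weighted sum of the vertices is affine
  in the units; these cancel, and the constant terms remain.\<close>

lemma symmedian_point: "symmedian_point A B C = K"
proof -
  have s: "1 + t\<^sup>2 > 0" by (simp add: add_pos_nonneg)
  have "p *\<^sub>R A + q *\<^sub>R B + r *\<^sub>R C = (3 * (1 + t\<^sup>2)) *\<^sub>R c + R *\<^sub>R Complex 0 (- (6 * t))"
    unfolding scaled_vertices rot_mult sum_weights[symmetric]
    by (simp add: complex_eq_iff algebra_simps)
  also have "\<dots> = (3 * (1 + t\<^sup>2)) *\<^sub>R K"
  proof -
    define k where "k = 2 * t / (1 + t\<^sup>2)"
    have "k * (1 + t\<^sup>2) = 2 * t" using s by (simp add: k_def)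
    hence "6 * t = 3 * (1 + t\<^sup>2) * k" by (simp add: algebra_simps)
    thus ?thesis unfolding K_def k_def[symmetric] by (simp add: complex_eq_iff algebra_simps)
  qed
  finally have e: "p *\<^sub>R A + q *\<^sub>R B + r *\<^sub>R C = (3 * (1 + t\<^sup>2)) *\<^sub>R K" .
  have "symmedian_point A B C = (1 / (g * p + g * q + g * r)) *\<^sub>R ((g * p) *\<^sub>R A + (g * q) *\<^sub>R B + (g * r) *\<^sub>R C)"
    by (rule symmedian_point_eq(1)[OF noncollinear side_lengths])
  also have "(g * p) *\<^sub>R A + (g * q) *\<^sub>R B + (g * r) *\<^sub>R C = g *\<^sub>R (p *\<^sub>R A + q *\<^sub>R B + r *\<^sub>R C)"
    by (simp add: scaleR_add_right)
  also have "g * p + g * q + g * r = g * (3 * (1 + t\<^sup>2))"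
    unfolding sum_weights[symmetric] by (simp add: algebra_simps)
  also have "(1 / (g * (3 * (1 + t\<^sup>2)))) *\<^sub>R g *\<^sub>R (p *\<^sub>R A + q *\<^sub>R B + r *\<^sub>R C) = K"
    unfolding e using g_pos s by simp
  finally show ?thesis .
qed

text \<open>One factor of each weight r p, p q, q r clears a denominator. The other leaves the sum r
  u + p (rot u) + q (cnj rot u), or its counterpart for the second point, neither of which depends
  on u.\<close>

lemma brocard_points:
  shows brocard_point1: "brocard_point1 A B C = c + R *\<^sub>R focus t"
    and brocard_point2: "brocard_point2 A B C = c + R *\<^sub>R (- cnj (focus t))"
proof -
  define k where "k = g\<^sup>2"
  have k: "k > 0" using g_pos by (simp add: k_def)
  have double_rot: "2 * Re (rot * u) = - Re u - sqrt 3 * Im u" "2 * Im (rot * u) = sqrt 3 * Re u - Im u"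
    "2 * Re (cnj rot * u) = - Re u + sqrt 3 * Im u" "2 * Im (cnj rot * u) = - (sqrt 3 * Re u) - Im u"
    unfolding rot_mult by simp_all
  have f1: "(3 * m) *\<^sub>R focus t =
      Complex ((1 - t\<^sup>2) * (3 / 2 * sqrt 3 * t)) ((1 + t\<^sup>2) * (3 / 2 * t) - 2 * t * (3 * (1 + t\<^sup>2)))"
    and f2: "(3 * m) *\<^sub>R (- cnj (focus t)) =
      Complex ((1 - t\<^sup>2) * - (3 / 2 * sqrt 3 * t)) ((1 + t\<^sup>2) * (3 / 2 * t) - 2 * t * (3 * (1 + t\<^sup>2)))"
    using m_pos unfolding focus_def m_def[symmetric] by (simp_all add: complex_eq_iff field_simps)
  have e1: "r *\<^sub>R (p *\<^sub>R A) + p *\<^sub>R (q *\<^sub>R B) + q *\<^sub>R (r *\<^sub>R C) = (3 * m) *\<^sub>R (c + R *\<^sub>R focus t)"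
  proof -
    \<comment> \<open>Real part of the complex sum -3 i t rot: its terms in u^2 carry the factor 1 +
      rot + cnj rot = 0. The imaginary part follows.\<close>
    have 1: "r * Re u + p * Re (rot * u) + q * Re (cnj rot * u) = 3 / 2 * sqrt 3 * t"
    proof -
      have "4 * (r * x + p * y + q * z) = 2 * (2 * r) * x + 2 * p * (2 * y) + (2 * q) * (2 * z)" for x y z :: real
        by algebra
      note this[of "Re u" "Re (rot * u)" "Re (cnj rot * u)"]
      also have "2 * (2 * r) * Re u + 2 * p * (2 * Re (rot * u)) + (2 * q) * (2 * Re (cnj rot * u)) =
          t * (6 * sqrt 3 * ((Re u)\<^sup>2 + (Im u)\<^sup>2) + 2 * Re u * Im u * (3 - (sqrt 3)\<^sup>2))"
        unfolding pqr_eq double_rot by algebra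
      also have "\<dots> = 4 * (3 / 2 * sqrt 3 * t)" unfolding sq by (simp add: algebra_simps)
      finally show ?thesis by (rule mult_left_cancel[THEN iffD1, rotated]) simp
    qed
    have 2: "r * Im u + p * Im (rot * u) + q * Im (cnj rot * u) = 3 / 2 * t"
    proof -
      have "4 * (r * x + p * y + q * z) = 2 * (2 * r) * x + 2 * p * (2 * y) + (2 * q) * (2 * z)" for x y z :: real
        by algebra
      note this[of "Im u" "Im (rot * u)" "Im (cnj rot * u)"]
      also have "2 * (2 * r) * Im u + 2 * p * (2 * Im (rot * u)) + (2 * q) * (2 * Im (cnj rot * u)) =
          t * (6 * ((Re u)\<^sup>2 + (Im u)\<^sup>2) - 2 * (Re u)\<^sup>2 * (3 - (sqrt 3)\<^sup>2))"
        unfolding pqr_eq double_rot by algebra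
      also have "\<dots> = 4 * (3 / 2 * t)" unfolding sq by (simp add: algebra_simps)
      finally show ?thesis by (rule mult_left_cancel[THEN iffD1, rotated]) simp
    qed
    have "r *\<^sub>R (p *\<^sub>R A) + p *\<^sub>R (q *\<^sub>R B) + q *\<^sub>R (r *\<^sub>R C) = (r * p + p * q + q * r) *\<^sub>R c +
       R *\<^sub>R Complex ((1 - t\<^sup>2) * (r * Re u + p * Re (rot * u) + q * Re (cnj rot * u)))
        ((1 + t\<^sup>2) * (r * Im u + p * Im (rot * u) + q * Im (cnj rot * u)) - 2 * t * (p + q + r))"
      unfolding scaled_vertices by (simp add: complex_eq_iff algebra_simps)
    also have "\<dots> = (3 * m) *\<^sub>R c + R *\<^sub>R ((3 * m) *\<^sub>R focus t)"
      unfolding 1 2 sum_weights sum_weight_products f1 ..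
    finally show ?thesis by (simp only: scaleR_add_right scaleR_scaleR mult_ac)
  qed
  have e2: "q *\<^sub>R (p *\<^sub>R A) + r *\<^sub>R (q *\<^sub>R B) + p *\<^sub>R (r *\<^sub>R C) = (3 * m) *\<^sub>R (c + R *\<^sub>R (- cnj (focus t)))"
  proof -
    have 1: "q * Re u + r * Re (rot * u) + p * Re (cnj rot * u) = - (3 / 2 * sqrt 3 * t)"
    proof -
      have "4 * (q * x + r * y + p * z) = 2 * (2 * q) * x + (2 * r) * (2 * y) + 2 * p * (2 * z)" for x y z :: real
        by algebra
      note this[of "Re u" "Re (rot * u)" "Re (cnj rot * u)"]
      also have "2 * (2 * q) * Re u + (2 * r) * (2 * Re (rot * u)) + 2 * p * (2 * Re (cnj rot * u)) =
          t * (- 6 * sqrt 3 * ((Re u)\<^sup>2 + (Im u)\<^sup>2) + 2 * Re u * Im u * (3 - (sqrt 3)\<^sup>2))"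
        unfolding pqr_eq double_rot by algebra
      also have "\<dots> = 4 * (- (3 / 2 * sqrt 3 * t))" unfolding sq by (simp add: algebra_simps)
      finally show ?thesis by (rule mult_left_cancel[THEN iffD1, rotated]) simp
    qed
    have 2: "q * Im u + r * Im (rot * u) + p * Im (cnj rot * u) = 3 / 2 * t"
    proof -
      have "4 * (q * x + r * y + p * z) = 2 * (2 * q) * x + (2 * r) * (2 * y) + 2 * p * (2 * z)" for x y z :: real
        by algebra
      note this[of "Im u" "Im (rot * u)" "Im (cnj rot * u)"]
      also have "2 * (2 * q) * Im u + (2 * r) * (2 * Im (rot * u)) + 2 * p * (2 * Im (cnj rot * u)) =
          t * (6 * ((Re u)\<^sup>2 + (Im u)\<^sup>2) - 2 * (Re u)\<^sup>2 * (3 - (sqrt 3)\<^sup>2))"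
        unfolding pqr_eq double_rot by algebra
      also have "\<dots> = 4 * (3 / 2 * t)" unfolding sq by (simp add: algebra_simps)
      finally show ?thesis by (rule mult_left_cancel[THEN iffD1, rotated]) simp
    qed
    have "q *\<^sub>R (p *\<^sub>R A) + r *\<^sub>R (q *\<^sub>R B) + p *\<^sub>R (r *\<^sub>R C) = (r * p + p * q + q * r) *\<^sub>R c +
       R *\<^sub>R Complex ((1 - t\<^sup>2) * (q * Re u + r * Re (rot * u) + p * Re (cnj rot * u)))
        ((1 + t\<^sup>2) * (q * Im u + r * Im (rot * u) + p * Im (cnj rot * u)) - 2 * t * (p + q + r))"
      unfolding scaled_vertices by (simp add: complex_eq_iff algebra_simps)
    also have "\<dots> = (3 * m) *\<^sub>R c + R *\<^sub>R ((3 * m) *\<^sub>R (- cnj (focus t)))"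
      unfolding 1 2 sum_weights sum_weight_products f2 ..
    finally show ?thesis by (simp only: scaleR_add_right scaleR_scaleR mult_ac)
  qed
  have den: "g * r * (g * p) + g * p * (g * q) + g * q * (g * r) = k * (3 * m)"
    unfolding sum_weight_products[symmetric] k_def by algebra
  have "brocard_point1 A B C = (1 / (k * (3 * m))) *\<^sub>R ((g * r * (g * p)) *\<^sub>R A + (g * p * (g * q)) *\<^sub>R B + (g * q * (g * r)) *\<^sub>R C)"
    using brocard_point1_eq[OF noncollinear side_lengths] unfolding den .
  also have "(g * r * (g * p)) *\<^sub>R A + (g * p * (g * q)) *\<^sub>R B + (g * q * (g * r)) *\<^sub>R C =
      k *\<^sub>R (r *\<^sub>R (p *\<^sub>R A) + p *\<^sub>R (q *\<^sub>R B) + q *\<^sub>R (r *\<^sub>R C))"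
    by (simp add: k_def scaleR_add_right power2_eq_square mult_ac)
  finally show "brocard_point1 A B C = c + R *\<^sub>R focus t"
    unfolding e1 using k m_pos by simp
  have "brocard_point2 A B C = (1 / (k * (3 * m))) *\<^sub>R ((g * p * (g * q)) *\<^sub>R A + (g * q * (g * r)) *\<^sub>R B + (g * r * (g * p)) *\<^sub>R C)"
    using brocard_point2_eq[OF noncollinear side_lengths] unfolding den .
  also have "(g * p * (g * q)) *\<^sub>R A + (g * q * (g * r)) *\<^sub>R B + (g * r * (g * p)) *\<^sub>R C =
      k *\<^sub>R (q *\<^sub>R (p *\<^sub>R A) + r *\<^sub>R (q *\<^sub>R B) + p *\<^sub>R (r *\<^sub>R C))"
    by (simp add: k_def scaleR_add_right power2_eq_square mult_ac)
  finally show "brocard_point2 A B C = c + R *\<^sub>R (- cnj (focus t))"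
    unfolding e2 using k m_pos by simp
qed

text \<open>The sum of the squared sides and the cross product both carry 1 / (p q r), the only
  quantity left that depends on u; it cancels.\<close>

lemma cot_brocard_angle: "cot (brocard_angle A B C) = sqrt 3 * (1 + t\<^sup>2) / (1 - t\<^sup>2)"
proof -
  define x where "x = R\<^sup>2 * (1 - t\<^sup>2)\<^sup>2 / (p * q * r)"
  have x: "x > 0" using R d_pos pqr_pos by (simp add: x_def)
  have "\<bar>Im (cnj (B - A) * (C - A))\<bar> = Im (cnj (B - A) * (C - A))" by (rule abs_of_pos[OF cross_pos])
  also have "\<dots> = x * (1 - t\<^sup>2) * (3 * sqrt 3 / 2)"
    unfolding cross_eq by (simp add: x_def power2_eq_square power3_eq_cube)
  finally have cr: "\<bar>Im (cnj (B - A) * (C - A))\<bar> = x * (1 - t\<^sup>2) * (3 * sqrt 3 / 2)" .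
  have "g * p + g * q + g * r = g * (p + q + r)" by algebra
  also have "\<dots> = x * (9 * (1 + t\<^sup>2))" unfolding sum_weights by (simp add: g_def x_def)
  finally have "cot (brocard_angle A B C) = x * (9 * (1 + t\<^sup>2)) / (x * (1 - t\<^sup>2) * (3 * sqrt 3))"
    using cot_brocard_angle[OF noncollinear side_lengths] unfolding cr by simp
  also have "x * (9 * (1 + t\<^sup>2)) = (sqrt 3 * (1 + t\<^sup>2)) * (x * (3 * sqrt 3))"
  proof -
    have e: "(sqrt 3 * (1 + t\<^sup>2)) * (x * (3 * sqrt 3)) = (sqrt 3)\<^sup>2 * (x * (3 * (1 + t\<^sup>2)))"
      by (simp only: power2_eq_square mult_ac)
    show ?thesis unfolding e sq by simp
  qed
  also have "x * (1 - t\<^sup>2) * (3 * sqrt 3) = (1 - t\<^sup>2) * (x * (3 * sqrt 3))" by simp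
  also have "(sqrt 3 * (1 + t\<^sup>2)) * (x * (3 * sqrt 3)) / \<dots> = sqrt 3 * (1 + t\<^sup>2) / (1 - t\<^sup>2)"
    using x by (intro mult_divide_mult_cancel_right) simp
  finally show ?thesis .
qed

text \<open>The proposed center is the midpoint of c and K. The foci lie on the circle because f^2 +
  h^2 = 2 h k, both sides being 3 t^2 / m.\<close>

lemma center_foci_cocircular:
  shows "\<not> collinear {c, c + R *\<^sub>R focus t, c + R *\<^sub>R (- cnj (focus t))}"
    and "X \<in> {c, c + R *\<^sub>R focus t, c + R *\<^sub>R (- cnj (focus t))} \<Longrightarrow>
      dist (c + R *\<^sub>R Complex 0 (- (t / (1 + t\<^sup>2)))) X = R * (t / (1 + t\<^sup>2))"
proof -
  define f where "f = sqrt 3 * t * (1 - t\<^sup>2) / (2 * m)"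
  define h where "h = 3 * t * (1 + t\<^sup>2) / (2 * m)"
  define k where "k = t / (1 + t\<^sup>2)"
  have s: "1 + t\<^sup>2 > 0" by (simp add: add_pos_nonneg)
  have pos: "f > 0" "h > 0" "k > 0" using t d_pos m_pos s by (simp_all add: f_def h_def k_def)
  have foc: "focus t = Complex f (- h)" by (simp add: focus_def f_def h_def m_def)
  have e: "Im (cnj (R *\<^sub>R focus t) * (R *\<^sub>R (- cnj (focus t)))) = - (2 * R\<^sup>2 * f * h)"
    by (simp add: foc power2_eq_square)
  show "\<not> collinear {c, c + R *\<^sub>R focus t, c + R *\<^sub>R (- cnj (focus t))}"
    unfolding noncollinear_iff add_diff_cancel_left' e using R pos by simp
  have "4 * m\<^sup>2 * (f\<^sup>2 + h\<^sup>2) = (2 * m * f)\<^sup>2 + (2 * m * h)\<^sup>2" by algebra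
  also have "\<dots> = 12 * t\<^sup>2 * m"
  proof -
    have e: "2 * m * f = sqrt 3 * t * (1 - t\<^sup>2)" "2 * m * h = 3 * t * (1 + t\<^sup>2)"
      using m_pos by (simp_all add: f_def h_def)
    show ?thesis unfolding e unfolding power_mult_distrib sq m_def by algebra
  qed
  finally have "m * (f\<^sup>2 + h\<^sup>2) = 3 * t\<^sup>2" using m_pos by (simp add: power2_eq_square)
  moreover have "m * (2 * h * k) = 3 * t\<^sup>2"
    using m_pos s by (simp add: h_def k_def power2_eq_square)
  ultimately have "m * (f\<^sup>2 + h\<^sup>2) = m * (2 * h * k)" by simp
  hence "f\<^sup>2 + h\<^sup>2 = 2 * h * k" using m_pos unfolding mult_cancel_left by simp
  hence n: "f\<^sup>2 + (h - k)\<^sup>2 = k\<^sup>2" by (simp add: power2_diff)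
  have *: "dist (c + R *\<^sub>R Complex 0 (- k)) (c + R *\<^sub>R z) = R * dist (Complex 0 (- k)) z" for z
    using R by (simp add: dist_norm flip: scaleR_diff_right)
  have **: "dist (Complex 0 (- k)) (Complex x (- h)) = k" if "x\<^sup>2 = f\<^sup>2" for x
  proof -
    have "(dist (Complex 0 (- k)) (Complex x (- h)))\<^sup>2 = k\<^sup>2"
      using n that by (simp add: dist_norm cmod_power2)
    thus ?thesis using pos by (simp add: power2_eq_iff_nonneg)
  qed
  have foc': "- cnj (focus t) = Complex (- f) (- h)" by (simp add: foc complex_eq_iff)
  assume "X \<in> {c, c + R *\<^sub>R focus t, c + R *\<^sub>R (- cnj (focus t))}"
  then consider "X = c + R *\<^sub>R 0" | "X = c + R *\<^sub>R Complex f (- h)" | "X = c + R *\<^sub>R Complex (- f) (- h)"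
    unfolding foc' unfolding foc by auto
  thus "dist (c + R *\<^sub>R Complex 0 (- (t / (1 + t\<^sup>2)))) X = R * (t / (1 + t\<^sup>2))"
  proof cases
    case 1
    have "dist (Complex 0 (- k)) 0 = k" using pos by (simp add: dist_norm cmod_def)
    thus ?thesis unfolding 1 k_def[symmetric] * by simp
  next
    case 2
    show ?thesis unfolding 2 k_def[symmetric] * by (simp only: **)
  next
    case 3
    show ?thesis unfolding 3 k_def[symmetric] * by (simp only: ** power2_minus)
  qed
qed

lemma X182: "X182 A B C = c + R *\<^sub>R Complex 0 (- (t / (1 + t\<^sup>2)))"
proof -
  have "dist (c + R *\<^sub>R Complex 0 (- (t / (1 + t\<^sup>2)))) X = R * (t / (1 + t\<^sup>2))"
    if "X = c \<or> X = c + R *\<^sub>R focus t \<or> X = c + R *\<^sub>R (- cnj (focus t))" for X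
    by (rule center_foci_cocircular(2)) (use that in blast)
  thus ?thesis
    unfolding X182_def circumcenter brocard_points
    by (intro circumcenter_eqI[OF center_foci_cocircular(1)]) metis+
qed

text \<open>Thales' form with diameter from c to K, as needed for
  \<open>foot_on_diametral_circle\<close>.\<close>

lemma mem_brocard_circle: "X \<in> brocard_circle A B C \<longleftrightarrow> inner (X - c) (X - K) = 0"
proof -
  define k where "k = t / (1 + t\<^sup>2)"
  define Z where "Z = c + R *\<^sub>R Complex 0 (- k)"
  have k: "k \<ge> 0" using t by (simp add: k_def)
  have cc: "circumcenter c (c + R *\<^sub>R focus t) (c + R *\<^sub>R (- cnj (focus t))) = Z"
    using X182 unfolding X182_def circumcenter brocard_points Z_def k_def .
  have "dist Z c = R * k" unfolding Z_def k_def by (rule center_foci_cocircular(2)) simp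
  hence "X \<in> brocard_circle A B C \<longleftrightarrow> (dist Z X)\<^sup>2 = (R * k)\<^sup>2"
    unfolding brocard_circle_def circumcenter brocard_points circumcircle_def circumradius_def cc
    using R k by (simp add: power2_eq_iff_nonneg)
  also have "\<dots> \<longleftrightarrow> inner (X - c) (X - K) = 0"
  proof -
    have "K = c + R *\<^sub>R Complex 0 (- (2 * k))" by (simp add: K_def k_def)
    hence "inner (X - c) (X - K) = (dist Z X)\<^sup>2 - (R * k)\<^sup>2"
      by (simp add: Z_def inner_complex_def dist_norm cmod_power2)
        (simp add: power2_eq_square algebra_simps)
    thus ?thesis by simp
  qed
  finally show ?thesis .
qed

lemma circumscribed_about: "circumscribed_about A B C (porism_ellipse c R t)"
  unfolding circumscribed_about_def A_def B_def C_def
  using side_tangent_porism[OF R abs_t] norm_units inner_rot[OF u] by blast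

lemma brocard_inellipse: "brocard_inellipse A B C = porism_ellipse c R t"
proof (rule brocard_inellipse_eqI[OF _ _ circumscribed_about])
  show "A \<noteq> B" using noncollinear_distinct[OF noncollinear] by blast
  show "is_ellipse (porism_ellipse c R t) (brocard_point1 A B C) (brocard_point2 A B C)
      (R * ((1 - t\<^sup>2) / (2 * sqrt m))) (R * ((1 - t\<^sup>2)\<^sup>2 / (2 * m)))"
    unfolding brocard_points by (rule porism_ellipse_is_ellipse[OF t R m_def])
qed

end

section \<open>Every 3-periodic is an orbit triangle\<close>

lemma porism_vertex_surj:
  assumes "R > 0" "\<bar>t\<bar> < 1" "X \<in> sphere c R"
  obtains u where "norm u = 1" "X = porism_vertex c R t u"
proof
  define z where "z = (1 / R) *\<^sub>R (X - c)"
  have "norm z = 1" using assms(1,3) by (simp add: z_def dist_norm norm_minus_commute)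
  thus "norm (boost (- t) z) = 1" "X = porism_vertex c R t (boost (- t) z)"
    using norm_boost[of "- t" z] boost_inverse[of t z] assms(1,2)
    by (simp_all add: porism_vertex_def z_def)
qed

lemma sum_units_eq_0:
  assumes "norm u = 1" "norm v = 1" "norm w = 1"
    "inner u v = - 1 / 2" "inner v w = - 1 / 2" "inner w u = - 1 / 2"
  shows "u + v + (w :: complex) = 0"
proof -
  have "inner (u + v + w) (u + v + w) = 0"
    using assms by (simp add: inner_add_left inner_add_right inner_commute norm_eq_1)
  thus ?thesis by simp
qed

text \<open>On the preimages of the vertices each tangent side means inner product -1/2, so the
  three units sum to zero and differ by thirds of a turn; the orientation fixes their order.\<close>

lemma three_periodic_parametrization:
  assumes R: "R > 0" and t: "0 < t" "t < 1"
    and tp: "three_periodic (sphere c R) (porism_ellipse c R t) A B C" and ccw: "counterclockwise A B C"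
  obtains u where "norm u = 1" "A = porism_vertex c R t u"
    "B = porism_vertex c R t (rot * u)" "C = porism_vertex c R t (cnj rot * u)"
proof -
  have at: "\<bar>t\<bar> < 1" using t by simp
  have mem: "A \<in> sphere c R" "B \<in> sphere c R" "C \<in> sphere c R" and nc: "\<not> collinear {A, B, C}"
    and circ: "circumscribed_about A B C (porism_ellipse c R t)"
    using tp unfolding three_periodic_def by blast+
  obtain u where u: "norm u = 1" "A = porism_vertex c R t u" using porism_vertex_surj[OF R at mem(1)] .
  obtain v where v: "norm v = 1" "B = porism_vertex c R t v" using porism_vertex_surj[OF R at mem(2)] .
  obtain w where w: "norm w = 1" "C = porism_vertex c R t w" using porism_vertex_surj[OF R at mem(3)] .
  have ne: "u \<noteq> v" "v \<noteq> w" "w \<noteq> u" using noncollinear_distinct[OF nc] u v w by auto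
  have "inner u v = - 1 / 2" "inner v w = - 1 / 2" "inner w u = - 1 / 2"
    using circ unfolding circumscribed_about_def u(2) v(2) w(2)
    using side_tangent_porismD[OF R at u(1) v(1) ne(1)] side_tangent_porismD[OF R at v(1) w(1) ne(2)]
      side_tangent_porismD[OF R at w(1) u(1) ne(3)] by blast+
  hence "u + v + w = 0" using sum_units_eq_0 u(1) v(1) w(1) by blast
  hence "v = rot * u \<and> w = cnj rot * u \<or> v = cnj rot * u \<and> w = rot * u"
    using equilateral_units u(1) v(1) w(1) by blast
  \<comment> \<open>In this order A, B, C would be an orbit triangle listed clockwise.\<close>
  moreover have "\<not> (v = cnj rot * u \<and> w = rot * u)"
  proof
    assume h: "v = cnj rot * u \<and> w = rot * u"
    interpret T: porism_triangle c R t u using R t u by unfold_locales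
    have "A = T.A" "B = T.C" "C = T.B"
      using h u v w by (simp_all add: T.A_def T.B_def T.C_def)
    hence "Im (cnj (C - A) * (B - A)) > 0" using T.cross_pos by simp
    moreover have "Im (cnj (C - A) * (B - A)) = - Im (cnj (B - A) * (C - A))" by (simp add: algebra_simps)
    ultimately show False using ccw unfolding counterclockwise_def by linarith
  qed
  ultimately show thesis using that u v w by blast
qed

section \<open>Normal form of a triangle under boosts\<close>

lemma circumcenter_exists:
  fixes A B C :: complex
  assumes "\<not> collinear {A, B, C}"
  shows "\<exists>X. dist X A = dist X B \<and> dist X B = dist X C"
proof -
  define v w where vw: "v = B - A" "w = C - A"
  define D where "D = Im (cnj v * w)"
  have D: "D \<noteq> 0" using assms unfolding noncollinear_iff D_def vw .
  \<comment> \<open>Cramer's rule for the equations 2 inner z v = inner v v and 2 inner z w = inner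
    w w. The quarter turn -i makes w orthogonal to itself and v to itself, so each term serves one
    equation.\<close>
  define z where "z = (1 / (2 * D)) *\<^sub>R (- \<i> * ((inner v v) *\<^sub>R w - (inner w w) *\<^sub>R v))"
  have e: "dist (A + z) A = dist (A + z) (A + y)" if "2 * inner z y = inner y y" for y
  proof -
    have "norm z ^ 2 = norm (z - y) ^ 2"
      using that by (simp add: power2_norm_eq_inner inner_diff_left inner_diff_right inner_commute)
    thus ?thesis by (simp add: dist_norm)
  qed
  have "2 * D * inner z v = D * inner v v" "2 * D * inner z w = D * inner w w"
    using D unfolding z_def inner_scaleR_left by (simp_all add: inner_complex_def D_def) algebra+
  hence "2 * inner z v = inner v v" "2 * inner z w = inner w w" using D by simp_all
  from e[OF this(1)] e[OF this(2)]
  have "dist (A + z) A = dist (A + z) B" "dist (A + z) A = dist (A + z) C" by (simp_all add: vw)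
  thus ?thesis by metis
qed

lemma dist_circumcenter:
  assumes "\<not> collinear {A, B, C}"
  shows "dist (circumcenter A B C) A = circumradius A B C"
    "dist (circumcenter A B C) B = circumradius A B C"
    "dist (circumcenter A B C) C = circumradius A B C"
    "circumradius A B C > 0"
proof -
  obtain X where X: "dist X A = dist X B" "dist X B = dist X C" using circumcenter_exists[OF assms] by blast
  have c: "circumcenter A B C = X" using circumcenter_eqI[OF assms X] .
  show "dist (circumcenter A B C) A = circumradius A B C"
    "dist (circumcenter A B C) B = circumradius A B C"
    "dist (circumcenter A B C) C = circumradius A B C"
    using X by (simp_all add: circumradius_def c)
  have "X \<noteq> A" using X noncollinear_distinct(1)[OF assms] by (metis dist_eq_0_iff)
  thus "circumradius A B C > 0" by (simp add: circumradius_def c)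
qed

lemma exists_boost_parameter:
  fixes k :: real
  assumes "0 < k" "k < 1"
  shows "\<exists>t. 0 < t \<and> t < 1 \<and> 2 * t / (1 + t\<^sup>2) = k"
proof -
  define w where "w = sqrt (1 - k\<^sup>2)"
  have k2: "k\<^sup>2 < 1" "k\<^sup>2 > 0" using assms by (simp_all add: power_less_one_iff)
  have w2: "w\<^sup>2 = 1 - k\<^sup>2" using k2 by (simp add: w_def)
  have w: "0 < w" "w < 1" using k2 by (simp_all add: w_def)
  \<comment> \<open>The smaller root of k t^2 - 2 t + k = 0, written without cancellation.\<close>
  define t where "t = k / (1 + w)"
  have kt: "k = t * (1 + w)" using w by (simp add: t_def)
  have t0: "t > 0" using assms w by (simp add: t_def)
  have "(1 + w) * ((1 + t\<^sup>2) * (1 + w) - 2) = 0"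
    using w2 unfolding kt by algebra
  hence s: "(1 + t\<^sup>2) * (1 + w) = 2" using w by simp
  have "t < 1" unfolding t_def using assms w by (simp add: divide_less_eq)
  moreover have "2 * t / (1 + t\<^sup>2) = k"
  proof -
    have "1 + t\<^sup>2 > 0" by (simp add: add_pos_nonneg)
    moreover have "k * (1 + t\<^sup>2) = t * ((1 + t\<^sup>2) * (1 + w))" unfolding kt by (simp only: mult_ac)
    hence "2 * t = k * (1 + t\<^sup>2)" unfolding s by simp
    ultimately show ?thesis by (simp add: divide_eq_eq)
  qed
  ultimately show ?thesis using t0 by blast
qed

text \<open>The symmedian weights turn under the boost into those of the preimage triangle, whose
  symmedian point is therefore its circumcentre; this forces it to be equilateral.\<close>

lemma units_symmedian_zero:
  assumes n: "norm u = 1" "norm v = 1" "norm w = 1" and ne: "u \<noteq> v" "v \<noteq> w" "w \<noteq> (u :: complex)"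
    and z: "(dist v w)\<^sup>2 *\<^sub>R u + (dist w u)\<^sup>2 *\<^sub>R v + (dist u v)\<^sup>2 *\<^sub>R w = 0"
  shows "u + v + w = 0"
proof -
  define a b c where abc: "a = (dist v w)\<^sup>2" "b = (dist w u)\<^sup>2" "c = (dist u v)\<^sup>2"
  have pos: "a > 0" "b > 0" "c > 0" using ne by (simp_all add: abc)
  have i: "inner x y = 1 - (dist x y)\<^sup>2 / 2" if "norm x = 1" "norm y = 1" for x y :: complex
    using that by (simp add: dist_norm power2_norm_eq_inner inner_diff_left inner_diff_right inner_commute norm_eq_1
        field_simps)
  have uv: "inner u v = 1 - c / 2" "inner v w = 1 - a / 2" "inner w u = 1 - b / 2"
    using i n by (simp_all add: abc)
  have uu: "inner u u = 1" "inner v v = 1" "inner w w = 1" using n by (simp_all add: norm_eq_1)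
  have z': "a *\<^sub>R u + b *\<^sub>R v + c *\<^sub>R w = 0" using z by (simp add: abc)
  have "inner (a *\<^sub>R u + b *\<^sub>R v + c *\<^sub>R w) x = 0" for x using z' by simp
  hence "a * inner u x + b * inner v x + c * inner w x = 0" for x by (simp add: inner_add_left)
  \<comment> \<open>Pairing the relation with u, v, w leads to a + b + c = b c = a c = a b, hence to
    equal sides.\<close>
  from this[of u] this[of v] this[of w]
  have "a + b * (1 - c / 2) + c * (1 - b / 2) = 0" "a * (1 - c / 2) + b + c * (1 - a / 2) = 0"
    "a * (1 - b / 2) + b * (1 - a / 2) + c = 0"
    unfolding uu uv inner_commute[of v u] inner_commute[of w v] inner_commute[of u w] by simp_all
  hence "a + b + c = b * c" "a + b + c = a * c" "a + b + c = a * b"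
    by (simp_all add: algebra_simps)
  hence "a = b" "b = c" using pos by auto
  hence "a *\<^sub>R (u + v + w) = 0" using z' by (simp add: scaleR_add_right)
  thus ?thesis using pos by simp
qed

text \<open>The boost is read off from the symmedian point: it must move 0 there after scaling by R.
  What remains is to bring the preimages into the relation of
  \<open>units_symmedian_zero\<close>.\<close>

lemma porism_normal_form:
  assumes nc: "\<not> collinear {A, B, C}" and c: "circumcenter A B C = 0"
    and K: "Re (symmedian_point A B C) = 0" "Im (symmedian_point A B C) < 0"
    and R: "R = circumradius A B C"
  obtains t u where "0 < t" "t < 1" "norm u = 1" "A = porism_vertex 0 R t u"
    "B = porism_vertex 0 R t (rot * u) \<and> C = porism_vertex 0 R t (cnj rot * u) \<or>
     B = porism_vertex 0 R t (cnj rot * u) \<and> C = porism_vertex 0 R t (rot * u)"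
proof -
  have R0: "R > 0" and d: "A \<in> sphere 0 R" "B \<in> sphere 0 R" "C \<in> sphere 0 R"
    using dist_circumcenter[OF nc] by (simp_all add: R c)
  \<comment> \<open>An interior point of the triangle lies strictly inside the circumcircle; hence k
    < 1 and a boost with t < 1 exists.\<close>
  have "convex hull {A, B, C} \<subseteq> cball 0 R"
    using d by (intro hull_minimal) auto
  from interior_mono[OF this] have "interior (convex hull {A, B, C}) \<subseteq> ball 0 R"
    by (simp only: interior_cball)
  hence "symmedian_point A B C \<in> ball 0 R"
    using symmedian_point_eq(2)[OF nc refl refl refl] by blast
  hence lt: "norm (symmedian_point A B C) < R" by simp
  define k where "k = - Im (symmedian_point A B C) / R"
  have "norm (symmedian_point A B C) = k * R"
    using K R0 by (simp add: cmod_def k_def)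
  hence "k * R < 1 * R" using lt by simp
  hence k: "0 < k" "k < 1"
    using R0 K(2) unfolding mult_less_cancel_right by (simp_all add: k_def divide_neg_pos)
  obtain t where t: "0 < t" "t < 1" "2 * t / (1 + t\<^sup>2) = k" using exists_boost_parameter[OF k] by blast
  have at: "\<bar>t\<bar> < 1" using t by simp
  obtain u where u: "norm u = 1" "A = porism_vertex 0 R t u" using porism_vertex_surj[OF R0 at d(1)] .
  obtain v where v: "norm v = 1" "B = porism_vertex 0 R t v" using porism_vertex_surj[OF R0 at d(2)] .
  obtain w where w: "norm w = 1" "C = porism_vertex 0 R t w" using porism_vertex_surj[OF R0 at d(3)] .
  have ne: "u \<noteq> v" "v \<noteq> w" "w \<noteq> u" using noncollinear_distinct[OF nc] u v w by auto
  define p q r where pqr: "p = boost_weight t u" "q = boost_weight t v" "r = boost_weight t w"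
  have pos: "p > 0" "q > 0" "r > 0" using boost_weight_pos[OF at] u(1) v(1) w(1) by (simp_all add: pqr)
  have dd: "1 - t\<^sup>2 > 0" using t by (simp add: power_less_one_iff)
  have s: "1 + t\<^sup>2 > 0" by (simp add: add_pos_nonneg)
  define g where "g = R\<^sup>2 * (1 - t\<^sup>2)\<^sup>2 / (p * q * r)"
  have g: "g > 0" using R0 dd pos by (simp add: g_def)
  define a b c where abc: "a = (dist v w)\<^sup>2" "b = (dist w u)\<^sup>2" "c = (dist u v)\<^sup>2"
  note * = dist_porism_vertex[OF R0 at, of _ _ 0]
  have sides: "g * (a * p) = (dist B C)\<^sup>2" "g * (b * q) = (dist C A)\<^sup>2" "g * (c * r) = (dist A B)\<^sup>2"
    using *[OF v(1) w(1)] *[OF w(1) u(1)] *[OF u(1) v(1)] pos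
    unfolding pqr[symmetric] abc[symmetric] u(2)[symmetric] v(2)[symmetric] w(2)[symmetric] g_def
    by (simp_all add: mult_ac)
  define S where "S = a * p + b * q + c * r"
  have S: "S > 0" using pos ne by (simp add: S_def abc add_pos_pos)
  note vec = boost_weight_scaleR_porism_vertex[of t _ 0 R]
  have "symmedian_point A B C = (1 / (g * (a * p) + g * (b * q) + g * (c * r))) *\<^sub>R
      ((g * (a * p)) *\<^sub>R A + (g * (b * q)) *\<^sub>R B + (g * (c * r)) *\<^sub>R C)"
    by (rule symmedian_point_eq(1)[OF nc sides])
  also have "(g * (a * p)) *\<^sub>R A + (g * (b * q)) *\<^sub>R B + (g * (c * r)) *\<^sub>R C =
      g *\<^sub>R (a *\<^sub>R (p *\<^sub>R A) + b *\<^sub>R (q *\<^sub>R B) + c *\<^sub>R (r *\<^sub>R C))"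
    by (simp add: scaleR_add_right)
  also have "g * (a * p) + g * (b * q) + g * (c * r) = g * S" by (simp add: S_def algebra_simps)
  finally have "S *\<^sub>R symmedian_point A B C = a *\<^sub>R (p *\<^sub>R A) + b *\<^sub>R (q *\<^sub>R B) + c *\<^sub>R (r *\<^sub>R C)"
    using g S by simp
  also have "symmedian_point A B C = R *\<^sub>R Complex 0 (- k)"
    using K R0 by (simp add: complex_eq_iff k_def)
  also have "p *\<^sub>R A = R *\<^sub>R Complex ((1 - t\<^sup>2) * Re u) ((1 + t\<^sup>2) * Im u - 2 * t)"
    using vec[of u] pos unfolding pqr u(2) by simp
  also have "q *\<^sub>R B = R *\<^sub>R Complex ((1 - t\<^sup>2) * Re v) ((1 + t\<^sup>2) * Im v - 2 * t)"
    using vec[of v] pos unfolding pqr v(2) by simp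
  also have "r *\<^sub>R C = R *\<^sub>R Complex ((1 - t\<^sup>2) * Re w) ((1 + t\<^sup>2) * Im w - 2 * t)"
    using vec[of w] pos unfolding pqr w(2) by simp
  finally have e: "S *\<^sub>R R *\<^sub>R Complex 0 (- k) =
      a *\<^sub>R R *\<^sub>R Complex ((1 - t\<^sup>2) * Re u) ((1 + t\<^sup>2) * Im u - 2 * t) +
      b *\<^sub>R R *\<^sub>R Complex ((1 - t\<^sup>2) * Re v) ((1 + t\<^sup>2) * Im v - 2 * t) +
      c *\<^sub>R R *\<^sub>R Complex ((1 - t\<^sup>2) * Re w) ((1 + t\<^sup>2) * Im w - 2 * t)" .
  have "R * ((1 - t\<^sup>2) * (a * Re u + b * Re v + c * Re w)) = 0"
    using arg_cong[OF e, of Re] by (simp add: algebra_simps)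
  hence X: "a * Re u + b * Re v + c * Re w = 0" using R0 dd by simp
  define Y where "Y = a * Im u + b * Im v + c * Im w"
  have "R * (- (S * k)) = R * ((1 + t\<^sup>2) * Y - 2 * t * (a + b + c))"
    using arg_cong[OF e, of Im] by (simp add: Y_def algebra_simps)
  hence "- (S * k) = (1 + t\<^sup>2) * Y - 2 * t * (a + b + c)"
    by (rule mult_left_cancel[THEN iffD1, rotated]) (use R0 in simp)
  \<comment> \<open>By the choice of t, 2 t = k (1 + t^2), the terms with a + b + c cancel and a
    nonzero multiple of Y is left.\<close>
  moreover have "S = (1 + t\<^sup>2) * (a + b + c) - 2 * t * Y"
    by (simp add: S_def Y_def pqr boost_weight_def algebra_simps)
  moreover have "2 * t = k * (1 + t\<^sup>2)" using t(3) s by (simp add: divide_eq_eq)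
  ultimately have "(1 - t\<^sup>2)\<^sup>2 * Y = 0" by algebra
  hence "Y = 0" using dd by simp
  hence "a *\<^sub>R u + b *\<^sub>R v + c *\<^sub>R w = 0" using X by (simp add: Y_def complex_eq_iff)
  hence "u + v + w = 0" using units_symmedian_zero[OF u(1) v(1) w(1) ne] by (simp add: abc)
  hence "v = rot * u \<and> w = cnj rot * u \<or> v = cnj rot * u \<and> w = rot * u"
    using equilateral_units u(1) v(1) w(1) by blast
  thus thesis using that[OF t(1,2) u] v w by blast
qed

section \<open>The second Brocard triangle\<close>

text \<open>The unit \<open>- \<i> u\<^sup>2\<close> runs backwards through the cube roots when \<open>u\<close> runs forwards;
  this is why \<open>T'\<close> is clockwise and its two Brocard points are exchanged.\<close>

lemma boost_foot:
  assumes R: "R > 0" and t: "0 < t" "t < 1" and u: "norm u = 1"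
    and R': "R' = R * t / (1 + t\<^sup>2)"
    and V: "V = porism_vertex 0 R t u" and K: "K = R *\<^sub>R Complex 0 (- (2 * t / (1 + t\<^sup>2)))"
    and P: "P = porism_vertex (Complex 0 (- R')) R' (t\<^sup>2) (- \<i> * u\<^sup>2)"
  shows "V \<noteq> K" "P \<in> affine hull {V, K}" "inner P (V - K) = 0"
proof -
  define x y s d where xysd: "x = Re u" "y = Im u" "s = 1 + t\<^sup>2" "d = 1 - t\<^sup>2"
  have xy: "x\<^sup>2 + y\<^sup>2 = 1" using u norm_eq_1_iff xysd by blast
  have s: "s > 0" by (simp add: xysd add_pos_nonneg)
  have d: "d > 0" using t by (simp add: xysd power_less_one_iff)
  define p where "p = s - 2 * t * y"
  have pw: "boost_weight t u = p" by (simp add: p_def xysd boost_weight_def)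
  have p: "p > 0" using boost_weight_pos[of t u] t u by (simp add: pw)
  \<comment> \<open>The squared norm of s x + i d y = u + t^2 cnj u, the direction of V - K; it is
    also the weight of the second boost.\<close>
  define W where "W = s\<^sup>2 * x\<^sup>2 + d\<^sup>2 * y\<^sup>2"
  have Ww: "boost_weight (t\<^sup>2) (- \<i> * u\<^sup>2) = W"
  proof -
    have "boost_weight (t\<^sup>2) (- \<i> * u\<^sup>2) = 1 + (t\<^sup>2)\<^sup>2 + 2 * t\<^sup>2 * (x\<^sup>2 - y\<^sup>2)"
      by (simp add: boost_weight_def xysd power2_eq_square algebra_simps)
    also have "\<dots> = W" unfolding W_def xysd(3,4) using xy by algebra
    finally show ?thesis .
  qed
  have W: "W > 0"
    using boost_weight_pos[of "t\<^sup>2" "- \<i> * u\<^sup>2"] t u unfolding Ww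
    by (simp add: norm_mult norm_power power_less_one_iff)
  have VK: "V - K = (R * d / (p * s)) *\<^sub>R Complex (s * x) (d * y)"
  proof (rule complex_eqI)
    show "Re (V - K) = Re ((R * d / (p * s)) *\<^sub>R Complex (s * x) (d * y))"
      using p s by (simp add: V K porism_vertex_def Re_boost pw xysd(1)[symmetric] xysd(4)[symmetric])
    have "(s * y - 2 * t) / p + 2 * t / s = (s * (s * y - 2 * t) + 2 * t * p) / (p * s)"
      using p s by (simp add: field_simps)
    also have "s * (s * y - 2 * t) + 2 * t * p = d * (d * y)" unfolding p_def xysd(3,4) by algebra
    finally have e: "(s * y - 2 * t) / p + 2 * t / s = d * (d * y) / (p * s)" .
    have "Im (V - K) = R * ((s * y - 2 * t) / p + 2 * t / s)"
      by (simp add: V K porism_vertex_def Im_boost pw xysd(2)[symmetric] xysd(3)[symmetric] distrib_left)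
    thus "Im (V - K) = Im ((R * d / (p * s)) *\<^sub>R Complex (s * x) (d * y))"
      unfolding e by simp
  qed
  have PP: "P = (2 * R * t * x / W) *\<^sub>R Complex (d * y) (- (s * x))"
  proof (rule complex_eqI)
    have re: "Re (- \<i> * u\<^sup>2) = 2 * x * y" and im: "Im (- \<i> * u\<^sup>2) = y\<^sup>2 - x\<^sup>2"
      by (simp_all add: xysd power2_eq_square)
    have 1: "1 - (t\<^sup>2)\<^sup>2 = s * d" unfolding xysd by algebra
    have "Re P = R' * ((1 - (t\<^sup>2)\<^sup>2) * (2 * x * y) / W)"
      unfolding P porism_vertex_def plus_complex.sel scaleR_complex.sel Re_boost Ww re by simp
    also have "\<dots> = Re ((2 * R * t * x / W) *\<^sub>R Complex (d * y) (- (s * x)))"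
      unfolding 1 R' xysd(3)[symmetric] using s by simp
    finally show "Re P = Re ((2 * R * t * x / W) *\<^sub>R Complex (d * y) (- (s * x)))" .
    have "Im P = R' * (((1 + (t\<^sup>2)\<^sup>2) * (y\<^sup>2 - x\<^sup>2) - 2 * t\<^sup>2) / W - 1)"
      unfolding P porism_vertex_def plus_complex.sel scaleR_complex.sel Im_boost Ww im by (simp add: algebra_simps)
    also have "((1 + (t\<^sup>2)\<^sup>2) * (y\<^sup>2 - x\<^sup>2) - 2 * t\<^sup>2) / W - 1 =
        ((1 + (t\<^sup>2)\<^sup>2) * (y\<^sup>2 - x\<^sup>2) - 2 * t\<^sup>2 - W) / W" using W by (simp add: diff_divide_distrib)
    also have "(1 + (t\<^sup>2)\<^sup>2) * (y\<^sup>2 - x\<^sup>2) - 2 * t\<^sup>2 - W = - (2 * s\<^sup>2 * x\<^sup>2)"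
      unfolding W_def xysd(3,4) using xy by algebra
    finally show "Im P = Im ((2 * R * t * x / W) *\<^sub>R Complex (d * y) (- (s * x)))"
      unfolding R' xysd(3)[symmetric] using s by (simp add: power2_eq_square)
  qed
  show "inner P (V - K) = 0"
    unfolding VK PP inner_scaleR_left inner_scaleR_right by (simp add: inner_complex_def)
  show "V \<noteq> K"
  proof
    assume "V = K"
    hence "(R * d / (p * s)) *\<^sub>R Complex (s * x) (d * y) = 0" using VK by simp
    hence "x = 0" "y = 0" using R p s d by (simp_all add: complex_eq_iff)
    thus False using xy by simp
  qed
  \<comment> \<open>The coefficient of the orthogonal projection of -K on the direction (s x, d y),
    whose squared norm is W.\<close>
  define \<mu> where "\<mu> = 2 * R * t * d * y / (s * W)"
  have "P = K + \<mu> *\<^sub>R Complex (s * x) (d * y)"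
  proof (rule complex_eqI)
    show "Re P = Re (K + \<mu> *\<^sub>R Complex (s * x) (d * y))"
      using s W by (simp add: PP K \<mu>_def)
    have "- (2 * t / s) + 2 * t * d * y / (s * W) * (d * y) = (- (2 * t * W) + 2 * t * d * y * (d * y)) / (s * W)"
      using s W by (simp add: field_simps)
    also have "- (2 * t * W) + 2 * t * d * y * (d * y) = s * (- (2 * t * x) * (s * x))"
      unfolding W_def by algebra
    also have "\<dots> / (s * W) = 2 * t * x / W * - (s * x)" using s by simp
    finally have e: "- (2 * t / s) + 2 * t * d * y / (s * W) * (d * y) = 2 * t * x / W * - (s * x)" .
    have "Im (K + \<mu> *\<^sub>R Complex (s * x) (d * y)) =
        R * (- (2 * t / s) + 2 * t * d * y / (s * W) * (d * y))"
      by (simp add: K \<mu>_def xysd(3)[symmetric] right_diff_distrib distrib_left mult_ac)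
    thus "Im P = Im (K + \<mu> *\<^sub>R Complex (s * x) (d * y))"
      unfolding e by (simp add: PP mult_ac)
  qed
  also have "Complex (s * x) (d * y) = (p * s / (R * d)) *\<^sub>R (V - K)"
    unfolding VK using R p s d by simp
  finally have "P = K + (\<mu> * (p * s / (R * d))) *\<^sub>R (V - K)" by simp
  thus "P \<in> affine hull {V, K}" unfolding insert_commute[of V] affine_hull_2_alt by blast
qed

text \<open>The identity (1 + t^2)^2 - (1 - t^2)^2 = (2 t)^2 makes \<sigma>^2 - 3 the square of 2
  sqrt 3 t / (1 - t^2), which turns \<open>Omega1\<close> and \<open>Omega2\<close> into multiples
  of the foci. It serves both orbits, with t and with t^2.\<close>

lemma porism_sigma:
  assumes t: "0 < t" "t < 1" and sg: "\<sigma> = sqrt 3 * (1 + t\<^sup>2) / (1 - t\<^sup>2)" and m: "m = 1 + t\<^sup>2 + t ^ 4"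
  shows "sqrt 3 < \<sigma>" "sqrt (\<sigma>\<^sup>2 - 3) = 2 * sqrt 3 * t / (1 - t\<^sup>2)" "\<sigma>\<^sup>2 + 1 = 4 * m / (1 - t\<^sup>2)\<^sup>2"
    "Omega1 R \<sigma> = R *\<^sub>R focus t" "Omega2 R \<sigma> = R *\<^sub>R (- cnj (focus t))"
proof -
  define d where "d = 1 - t\<^sup>2"
  have d: "d > 0" using t by (simp add: d_def power_less_one_iff)
  have m0: "m > 0" using t by (simp add: m add_pos_pos)
  have s2: "\<sigma>\<^sup>2 = 3 * (1 + t\<^sup>2)\<^sup>2 / d\<^sup>2" by (simp add: sg d_def power_divide power_mult_distrib)
  have "sqrt 3 * d < sqrt 3 * (1 + t\<^sup>2)" using t by (simp add: d_def)
  thus "sqrt 3 < \<sigma>" using d by (simp add: sg d_def[symmetric] less_divide_eq)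
  have "\<sigma>\<^sup>2 - 3 = (3 * (1 + t\<^sup>2)\<^sup>2 - 3 * d\<^sup>2) / d\<^sup>2" unfolding s2 using d by (simp add: diff_divide_distrib)
  also have "3 * (1 + t\<^sup>2)\<^sup>2 - 3 * d\<^sup>2 = 3 * (2 * t)\<^sup>2" unfolding d_def by algebra
  finally have "\<sigma>\<^sup>2 - 3 = 3 * (2 * t)\<^sup>2 / d\<^sup>2" .
  hence r: "sqrt (\<sigma>\<^sup>2 - 3) = 2 * sqrt 3 * t / d"
    using t d by (simp only: real_sqrt_divide real_sqrt_mult real_sqrt_abs) simp
  thus "sqrt (\<sigma>\<^sup>2 - 3) = 2 * sqrt 3 * t / (1 - t\<^sup>2)" by (simp add: d_def)
  have "\<sigma>\<^sup>2 + 1 = (3 * (1 + t\<^sup>2)\<^sup>2 + d\<^sup>2) / d\<^sup>2" unfolding s2 using d by (simp add: add_divide_distrib)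
  also have "3 * (1 + t\<^sup>2)\<^sup>2 + d\<^sup>2 = 4 * m" unfolding d_def m by algebra
  finally have q: "\<sigma>\<^sup>2 + 1 = 4 * m / d\<^sup>2" .
  thus "\<sigma>\<^sup>2 + 1 = 4 * m / (1 - t\<^sup>2)\<^sup>2" by (simp add: d_def)
  have f: "R * sqrt (\<sigma>\<^sup>2 - 3) / (\<sigma>\<^sup>2 + 1) = R * (sqrt 3 * t * d / (2 * m))"
    unfolding r q using d m0 by (simp add: power2_eq_square field_simps)
  have g: "sqrt 3 * t * d / (2 * m) * \<sigma> = 3 * t * (1 + t\<^sup>2) / (2 * m)"
  proof -
    have e: "sqrt 3 * (sqrt 3 * x) = 3 * x" for x :: real by (simp flip: mult.assoc)
    show ?thesis unfolding sg d_def[symmetric] using d m0 by (simp add: e)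
  qed
  have foc: "focus t = (sqrt 3 * t * d / (2 * m)) *\<^sub>R Complex 1 (- \<sigma>)"
  proof (rule complex_eqI)
    have "Im ((sqrt 3 * t * d / (2 * m)) *\<^sub>R Complex 1 (- \<sigma>)) = - (sqrt 3 * t * d / (2 * m) * \<sigma>)"
      by simp
    also have "\<dots> = Im (focus t)" unfolding g by (simp add: focus_def m)
    finally show "Im (focus t) = Im ((sqrt 3 * t * d / (2 * m)) *\<^sub>R Complex 1 (- \<sigma>))" ..
  qed (simp add: focus_def d_def m)
  show "Omega1 R \<sigma> = R *\<^sub>R focus t" unfolding Omega1_def f foc by simp
  show "Omega2 R \<sigma> = R *\<^sub>R (- cnj (focus t))" unfolding Omega2_def f foc by (simp add: complex_eq_iff)
qed

lemma X182_swap: "X182 A C B = X182 A B C"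
  unfolding X182_def circumcenter_swap[of A C B] brocard_point1_swap[of A C B] brocard_point2_swap[of A C B]
  by (rule circumcenter_swap)

theorem theorem1:
  fixes A0 B0 C0 :: complex and \<Gamma> E :: "complex set" and R \<omega> \<sigma> :: real
  assumes "\<not> collinear {A0, B0, C0}" and "\<not> equilateral A0 B0 C0"
    and "\<Gamma> = circumcircle A0 B0 C0" and "E = brocard_inellipse A0 B0 C0"
    and "R = circumradius A0 B0 C0" and "\<omega> = brocard_angle A0 B0 C0" and "\<sigma> = cot \<omega>"
    and "circumcenter A0 B0 C0 = Complex 0 0"
    and "Re (symmedian_point A0 B0 C0) = 0" and "Im (symmedian_point A0 B0 C0) < 0"
  shows "sqrt 3 < \<sigma> \<and>
    (let R' = R * sqrt (\<sigma>\<^sup>2 - 3) / (2 * \<sigma>);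
         X3' = Complex 0 (- R');
         \<sigma>' = (\<sigma>\<^sup>2 + 3) / (2 * \<sigma>);
         a' = R' * (1 / sqrt (\<sigma>'\<^sup>2 + 1));
         b' = R' * (2 / (\<sigma>'\<^sup>2 + 1));
         \<Omega>1' = Omega2 R' \<sigma>' + X3';
         \<Omega>2' = Omega1 R' \<sigma>' + X3'
     in \<exists>\<Gamma>' E'. brocard_porism \<Gamma>' E' \<and> \<Gamma>' = sphere X3' R' \<and> is_ellipse E' \<Omega>1' \<Omega>2' a' b' \<and>
       (\<forall>A B C. three_periodic \<Gamma> E A B C \<and> counterclockwise A B C \<longrightarrow>
         (let A' = second_brocard_vertex A B C A;
              B' = second_brocard_vertex A B C B;
              C' = second_brocard_vertex A B C C
          in three_periodic \<Gamma>' E' A' B' C' \<and>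
             circumcircle A' B' C' = \<Gamma>' \<and>
             brocard_inellipse A' B' C' = E' \<and>
             circumradius A' B' C' = R' \<and>
             circumcenter A' B' C' = X3' \<and>
             cot (brocard_angle A' B' C') = \<sigma>' \<and>
             brocard_point1 A' B' C' = \<Omega>1' \<and>
             brocard_point2 A' B' C' = \<Omega>2' \<and>
             X182 A' B' C' = Complex 0 (- (3 * R' * (\<sigma>\<^sup>2 + 1) / (4 * \<sigma>' * \<sigma>))))))"
proof -
  have c0: "circumcenter A0 B0 C0 = 0" using assms(8) by (simp add: complex_eq_iff)
  have R: "R > 0" using dist_circumcenter(4)[OF assms(1)] assms(5) by simp
  obtain t u where t: "0 < t" "t < 1" and u: "norm u = 1" and A0: "A0 = porism_vertex 0 R t u"
    and BC: "B0 = porism_vertex 0 R t (rot * u) \<and> C0 = porism_vertex 0 R t (cnj rot * u) \<or>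
     B0 = porism_vertex 0 R t (cnj rot * u) \<and> C0 = porism_vertex 0 R t (rot * u)"
    using porism_normal_form[OF assms(1) c0 assms(9,10,5)] .
  interpret L: porism_triangle 0 R t u using R t u by unfold_locales
  \<comment> \<open>The reference triangle may have either orientation; circumcircle, inellipse and
    Brocard angle are the same for both.\<close>
  have "B0 = L.B \<and> C0 = L.C \<or> B0 = L.C \<and> C0 = L.B"
    using BC by (simp only: L.B_def L.C_def)
  hence inv: "\<Gamma> = sphere 0 R \<and> E = porism_ellipse 0 R t \<and> \<sigma> = sqrt 3 * (1 + t\<^sup>2) / (1 - t\<^sup>2)"
    using A0[folded L.A_def] assms(3,4,6,7) L.circumcircle L.brocard_inellipse L.cot_brocard_angle
      circumcircle_swap[of L.A L.C L.B] brocard_inellipse_swap[of L.A L.C L.B]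
      brocard_angle_swap[of L.A L.C L.B] by auto
  define m where "m = 1 + t\<^sup>2 + t ^ 4"
  note sg = porism_sigma[OF t inv[THEN conjunct2, THEN conjunct2] m_def]
  have sg0: "\<sigma> > 0" using sg(1) real_sqrt_gt_0_iff[of 3] by linarith
  have d: "1 - t\<^sup>2 > 0" and s: "1 + t\<^sup>2 > 0" and m: "m > 0" by (rule L.d_pos, simp add: add_pos_nonneg, rule L.m_pos[unfolded L.m_def, folded m_def])
  \<comment> \<open>Radius and, next, center of the Brocard circle of the given porism, on which T'
    is inscribed; \<sigma>' is then set to the cotangent belonging to the parameter t^2.\<close>
  define R' where "R' = R * t / (1 + t\<^sup>2)"
  define X where "X = Complex 0 (- R')"
  define \<sigma>' where "\<sigma>' = sqrt 3 * (1 + (t\<^sup>2)\<^sup>2) / (1 - (t\<^sup>2)\<^sup>2)"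
  define m' where "m' = 1 + (t\<^sup>2)\<^sup>2 + (t\<^sup>2) ^ 4"
  have R': "R' > 0" using R t s by (simp add: R'_def)
  have t2: "0 < t\<^sup>2" "t\<^sup>2 < 1" using t by (simp_all add: power_less_one_iff)
  note sg' = porism_sigma[OF t2 \<sigma>'_def m'_def]
  have eqR: "R * sqrt (\<sigma>\<^sup>2 - 3) / (2 * \<sigma>) = R'"
    unfolding sg(2) using inv d s by (simp add: R'_def)
  have sq: "\<sigma>\<^sup>2 + 3 = 6 * (1 + (t\<^sup>2)\<^sup>2) / (1 - t\<^sup>2)\<^sup>2"
  proof -
    have "\<sigma>\<^sup>2 + 3 = 4 * m / (1 - t\<^sup>2)\<^sup>2 + 2" using sg(3) by simp
    also have "\<dots> = (4 * m + 2 * (1 - t\<^sup>2)\<^sup>2) / (1 - t\<^sup>2)\<^sup>2" using d by (simp add: add_divide_distrib)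
    also have "4 * m + 2 * (1 - t\<^sup>2)\<^sup>2 = 6 * (1 + (t\<^sup>2)\<^sup>2)" unfolding m_def by algebra
    finally show ?thesis .
  qed
  have eqS: "(\<sigma>\<^sup>2 + 3) / (2 * \<sigma>) = \<sigma>'"
  proof -
    have "\<sigma>' * (2 * \<sigma>) = (sqrt 3 * sqrt 3) * (2 * (1 + (t\<^sup>2)\<^sup>2) * (1 + t\<^sup>2)) / ((1 - (t\<^sup>2)\<^sup>2) * (1 - t\<^sup>2))"
      unfolding \<sigma>'_def inv[THEN conjunct2, THEN conjunct2] by (simp only: times_divide_eq_left times_divide_eq_right divide_divide_eq_left mult_ac)
    also have "(1 - (t\<^sup>2)\<^sup>2) * (1 - t\<^sup>2) = (1 - t\<^sup>2)\<^sup>2 * (1 + t\<^sup>2)" by algebra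
    also have "(sqrt 3 * sqrt 3) * (2 * (1 + (t\<^sup>2)\<^sup>2) * (1 + t\<^sup>2)) / ((1 - t\<^sup>2)\<^sup>2 * (1 + t\<^sup>2)) = \<sigma>\<^sup>2 + 3"
      unfolding sq using s by simp
    finally show ?thesis using sg0 by (simp add: divide_eq_eq)
  qed
  \<comment> \<open>The right side is the depth below 0 of the center in
    \<open>porism_triangle.X182\<close>, for circle center \<open>X\<close>, radius
    \<open>R'\<close> and parameter t^2.\<close>
  have eqX: "3 * R' * (\<sigma>\<^sup>2 + 1) / (4 * \<sigma>' * \<sigma>) = R' + R' * (t\<^sup>2 / (1 + (t\<^sup>2)\<^sup>2))"
  proof -
    have s': "1 + (t\<^sup>2)\<^sup>2 > 0" by (simp add: add_pos_nonneg)
    have "4 * \<sigma>' * \<sigma> = 2 * (\<sigma>\<^sup>2 + 3)" unfolding eqS[symmetric] using sg0 by simp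
    hence "3 * R' * (\<sigma>\<^sup>2 + 1) / (4 * \<sigma>' * \<sigma>) =
        3 * R' * (4 * m / (1 - t\<^sup>2)\<^sup>2) / (2 * (6 * (1 + (t\<^sup>2)\<^sup>2) / (1 - t\<^sup>2)\<^sup>2))"
      unfolding sq sg(3) by (simp only:)
    also have "\<dots> = R' * (m / (1 + (t\<^sup>2)\<^sup>2))"
    proof -
      have gen: "3 * R' * (4 * m / D) / (2 * (6 * e / D)) = R' * (m / e)" if "D > 0" "e > 0" for D e :: real
        using that by simp
      show ?thesis by (rule gen) (use d s' in simp_all)
    qed
    also have "m = (1 + (t\<^sup>2)\<^sup>2) + t\<^sup>2" unfolding m_def by algebra
    also have "R' * ((1 + (t\<^sup>2)\<^sup>2 + t\<^sup>2) / (1 + (t\<^sup>2)\<^sup>2)) = R' + R' * (t\<^sup>2 / (1 + (t\<^sup>2)\<^sup>2))"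
      using s' by (simp add: add_divide_distrib distrib_left)
    finally show ?thesis .
  qed
  have \<Omega>1: "Omega2 R' \<sigma>' + X = X + R' *\<^sub>R (- cnj (focus (t\<^sup>2)))"
    and \<Omega>2: "Omega1 R' \<sigma>' + X = X + R' *\<^sub>R focus (t\<^sup>2)"
    unfolding sg' by simp_all
  have ell: "is_ellipse (porism_ellipse X R' (t\<^sup>2)) (Omega2 R' \<sigma>' + X) (Omega1 R' \<sigma>' + X)
      (R' * (1 / sqrt (\<sigma>'\<^sup>2 + 1))) (R' * (2 / (\<sigma>'\<^sup>2 + 1)))"
  proof -
    have "(t\<^sup>2)\<^sup>2 < 1" by (rule abs_square_less_1[THEN iffD2]) (use t2 in simp)
    hence d': "1 - (t\<^sup>2)\<^sup>2 > 0" by linarith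
    have m': "m' > 0" by (simp add: m'_def add_pos_nonneg)
    have "sqrt (4 * m' / (1 - (t\<^sup>2)\<^sup>2)\<^sup>2) = 2 * sqrt m' / (1 - (t\<^sup>2)\<^sup>2)"
      using d' by (simp add: real_sqrt_divide real_sqrt_mult)
    hence "1 / sqrt (\<sigma>'\<^sup>2 + 1) = (1 - (t\<^sup>2)\<^sup>2) / (2 * sqrt m')" unfolding sg'(3) by simp
    moreover have "2 / (\<sigma>'\<^sup>2 + 1) = (1 - (t\<^sup>2)\<^sup>2)\<^sup>2 / (2 * m')" unfolding sg'(3) using m' by simp
    ultimately show ?thesis
      using porism_ellipse_is_ellipse[OF t2 R' m'_def, of X] unfolding \<Omega>1 \<Omega>2
      by (simp only: is_ellipse_commute)
  qed
  have por: "brocard_porism (sphere X R') (porism_ellipse X R' (t\<^sup>2))"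
  proof -
    \<comment> \<open>Any triangle of the second orbit witnesses the porism; the unit 1 selects
      one.\<close>
    interpret M: porism_triangle X R' "t\<^sup>2" 1 using R' t2 by unfold_locales simp_all
    show ?thesis
      unfolding brocard_porism_def using M.noncollinear M.circumcircle M.brocard_inellipse by metis
  qed
  have main: "three_periodic (sphere X R') (porism_ellipse X R' (t\<^sup>2)) A' B' C' \<and>
      circumcircle A' B' C' = sphere X R' \<and>
      brocard_inellipse A' B' C' = porism_ellipse X R' (t\<^sup>2) \<and>
      circumradius A' B' C' = R' \<and> circumcenter A' B' C' = X \<and>
      cot (brocard_angle A' B' C') = \<sigma>' \<and>
      brocard_point1 A' B' C' = Omega2 R' \<sigma>' + X \<and>
      brocard_point2 A' B' C' = Omega1 R' \<sigma>' + X \<and>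
      X182 A' B' C' = Complex 0 (- (3 * R' * (\<sigma>\<^sup>2 + 1) / (4 * \<sigma>' * \<sigma>)))"
    if tp: "three_periodic \<Gamma> E A B C" "counterclockwise A B C"
      and A': "A' = second_brocard_vertex A B C A" and B': "B' = second_brocard_vertex A B C B"
      and C': "C' = second_brocard_vertex A B C C" for A B C A' B' C'
  proof -
    have "three_periodic (sphere 0 R) (porism_ellipse 0 R t) A B C" using tp(1) inv by simp
    from three_periodic_parametrization[OF R t this tp(2)] obtain v where v: "norm v = 1"
      "A = porism_vertex 0 R t v" "B = porism_vertex 0 R t (rot * v)" "C = porism_vertex 0 R t (cnj rot * v)" .
    interpret T: porism_triangle 0 R t v using R t v by unfold_locales
    have ABC: "A = T.A" "B = T.B" "C = T.C" using v by (simp_all only: T.A_def T.B_def T.C_def)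
    have K: "T.K = R *\<^sub>R Complex 0 (- (2 * t / (1 + t\<^sup>2)))" by (simp add: T.K_def)
    have vertex: "second_brocard_vertex A B C (porism_vertex 0 R t z) =
        porism_vertex X R' (t\<^sup>2) (- \<i> * z\<^sup>2)" if "norm z = 1" for z
    proof -
      note foot = boost_foot[OF R t that R'_def refl K refl, folded X_def]
      show ?thesis
        unfolding second_brocard_vertex_def Let_def ABC T.symmedian_point
        by (rule foot_on_diametral_circle[OF foot(1,2), of 0]) (use foot(3) T.mem_brocard_circle in simp_all)
    qed
    define w where "w = - \<i> * v\<^sup>2"
    have w: "norm w = 1" using v(1) by (simp add: w_def norm_mult norm_power)
    interpret T': porism_triangle X R' "t\<^sup>2" w using R' t2 w by unfold_locales
    have rr: "rot\<^sup>2 = cnj rot" "(cnj rot)\<^sup>2 = rot"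
      by (simp_all add: rot_def complex_eq_iff power2_eq_square)
    \<comment> \<open>Squaring turns rot into cnj rot, so B' and C' arrive in the order opposite to
      that of the orbit triangle.\<close>
    have "- \<i> * (rot * v)\<^sup>2 = cnj rot * w" "- \<i> * (cnj rot * v)\<^sup>2 = rot * w"
      unfolding power_mult_distrib rr w_def by simp_all
    hence vs: "A' = T'.A" "B' = T'.C" "C' = T'.B"
      using vertex[OF T.norm_units(1)] vertex[OF T.norm_units(2)] vertex[OF T.norm_units(3)]
      unfolding A' B' C' T'.A_def T'.B_def T'.C_def v(2,3,4)[symmetric] w_def[symmetric] by simp_all
    have "{T'.A, T'.C, T'.B} \<subseteq> sphere X R'" using T'.dist_center by simp
    moreover have "\<not> collinear {T'.A, T'.C, T'.B}" using T'.noncollinear by (simp add: insert_commute)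
    moreover have "circumscribed_about T'.A T'.C T'.B (porism_ellipse X R' (t\<^sup>2))"
      using T'.circumscribed_about circumscribed_about_swap by blast
    moreover have "circumradius T'.A T'.C T'.B = R'"
      using T'.circumradius by (simp add: circumradius_def circumcenter_swap[of T'.A T'.C T'.B])
    moreover have "X182 T'.A T'.C T'.B = Complex 0 (- (3 * R' * (\<sigma>\<^sup>2 + 1) / (4 * \<sigma>' * \<sigma>)))"
      unfolding X182_swap[of T'.A T'.C T'.B] T'.X182 eqX by (simp add: X_def complex_eq_iff)
    ultimately show ?thesis
      unfolding vs three_periodic_def \<Omega>1 \<Omega>2 circumcircle_swap[of T'.A T'.C T'.B]
        brocard_inellipse_swap[of T'.A T'.C T'.B] brocard_angle_swap[of T'.A T'.C T'.B]
        brocard_point1_swap[of T'.A T'.C T'.B] brocard_point2_swap[of T'.A T'.C T'.B]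
        circumcenter_swap[of T'.A T'.C T'.B]
        T'.circumcircle T'.brocard_inellipse T'.circumcenter T'.cot_brocard_angle T'.brocard_points
        \<sigma>'_def[symmetric]
      by blast
  qed
  show ?thesis
    unfolding Let_def eqR eqS X_def[symmetric]
  proof (rule conjI[OF sg(1)], rule exI[of _ "sphere X R'"], rule exI[of _ "porism_ellipse X R' (t\<^sup>2)"],
      intro conjI[OF por] conjI[OF refl] conjI[OF ell] allI impI, goal_cases)
    case (1 A B C)
    show ?case by (rule main[OF conjunct1[OF 1] conjunct2[OF 1] refl refl refl])
  qed
qed

end
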